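(* Let $G$ be a locally compact group which has a compact open subgroup. Then $\mathcal P(G)$ is a multiplier Hopf $^*$-subalgebra of $C_0(G)$ which separates the points of $G$ and which is invariant under the left and right actions $f\mapsto {}_xf$ and $f\mapsto f_x$ ($x\in G$), where ${}_xf(y)=f(x^{-1}y)$ and $f_x(y)=f(yx)$.
   Context: $C_0(G)$ denotes the continuous complex functions on $G$ vanishing at infinity. A multiplier Hopf $^*$-subalgebra of $C_0(G)$ is a $^*$-subalgebra $\mathcal A\subseteq C_0(G)$ which is invariant under the antipode $S(f)(x)=f(x^{-1})$ and satisfies $\operatorname{span}\{\Delta(f)(1\otimes g)\mid f,g\in\mathcal A\}=\mathcal A\otimes\mathcal A$, where $\Delta(f)(1\otimes g)$ is the function $(x,y)\mapsto f(xy)g(y)$ and $\mathcal A\otimes\mathcal A$ is the space of finite sums of functions $(x,y)\mapsto a(x)b(y)$ with $a,b\in\mathcal A$. For a compact group $H$, $\mathcal P(H)$ is the set of $f\in C(H)$ for which there are finitely many $f_i,g_i\in C(H)$ with $f(hk)=\sum_i f_i(h)g_i(k)$ for all $h,k\in H$. $\mathcal P(G)$ is the set of $f\in C_c(G)$ such that for some compact open subgroup $H$ of $G$ there exist finitely many $f_i\in C_c(G)$ and $\phi_i\in C(H)$ with $f(xh)=\sum_i f_i(x)\phi_i(h)$ for all $x\in G,h\in H$. *)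

theory Defs
  imports "HOL-Analysis.Analysis"
begin

text \<open>Groups are written additively: the group G is a type 'g of class
  topological_group_add (continuous addition and negation), with the group
  operation x + y playing the role of xy and -x the role of x^{-1}.
  Local compactness and the Hausdorff property are explicit assumptions.\<close>

definition C0 :: "('g::topological_space \<Rightarrow> complex) set" where
  "C0 = {f. continuous_on UNIV f \<and> (\<forall>e>0. compact {x. e \<le> norm (f x)})}"

definition Cc :: "('g::topological_space \<Rightarrow> complex) set" where
  "Cc = {f. continuous_on UNIV f \<and> compact (closure {x. f x \<noteq> 0})}"

definition compact_open_subgroup :: "'g::{topological_space, group_add} set \<Rightarrow> bool" where
  "compact_open_subgroup H \<longleftrightarrow> compact H \<and> open H \<and> 0 \<in> H \<and>
     (\<forall>x\<in>H. \<forall>y\<in>H. x + y \<in> H) \<and> (\<forall>x\<in>H. - x \<in> H)"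

definition PG :: "('g::{topological_space, group_add} \<Rightarrow> complex) set" where
  "PG = {f. f \<in> Cc \<and> (\<exists>H. compact_open_subgroup H \<and>
      (\<exists>(n::nat) (fs :: nat \<Rightarrow> 'g \<Rightarrow> complex) (\<phi> :: nat \<Rightarrow> 'g \<Rightarrow> complex).
          (\<forall>i<n. fs i \<in> Cc \<and> continuous_on H (\<phi> i)) \<and>
          (\<forall>x. \<forall>h\<in>H. f (x + h) = (\<Sum>i<n. fs i x * \<phi> i h))))}"

text \<open>Delta(f)(1 \<otimes> g) : (x,y) \<mapsto> f(xy) g(y).\<close>
definition delta_one :: "('g::plus \<Rightarrow> complex) \<Rightarrow> ('g \<Rightarrow> complex) \<Rightarrow> ('g \<times> 'g \<Rightarrow> complex)" where
  "delta_one f g = (\<lambda>(x, y). f (x + y) * g y)"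

definition alg_tensor :: "('g \<Rightarrow> complex) set \<Rightarrow> ('g \<times> 'g \<Rightarrow> complex) set" where
  "alg_tensor A = {(\<lambda>(x, y). \<Sum>i<n. a i x * b i y) | n a b. \<forall>i<(n::nat). a i \<in> A \<and> b i \<in> A}"

definition cspan_fun :: "('b \<Rightarrow> complex) set \<Rightarrow> ('b \<Rightarrow> complex) set" where
  "cspan_fun S = {(\<lambda>z. \<Sum>i<n. c i * F i z) | n c F. \<forall>i<(n::nat). F i \<in> S}"

definition star_subalgebra :: "('g \<Rightarrow> complex) set \<Rightarrow> bool" where
  "star_subalgebra A \<longleftrightarrow> (\<lambda>x. 0) \<in> A \<and>
     (\<forall>f\<in>A. \<forall>g\<in>A. (\<lambda>x. f x + g x) \<in> A) \<and>
     (\<forall>c. \<forall>f\<in>A. (\<lambda>x. c * f x) \<in> A) \<and>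
     (\<forall>f\<in>A. \<forall>g\<in>A. (\<lambda>x. f x * g x) \<in> A) \<and>
     (\<forall>f\<in>A. (\<lambda>x. cnj (f x)) \<in> A)"

definition multiplier_hopf_star_subalgebra :: "('g::{topological_space, group_add} \<Rightarrow> complex) set \<Rightarrow> bool" where
  "multiplier_hopf_star_subalgebra A \<longleftrightarrow>
     A \<subseteq> C0 \<and> star_subalgebra A \<and>
     (\<forall>f\<in>A. (\<lambda>x. f (- x)) \<in> A) \<and>
     cspan_fun {delta_one f g | f g. f \<in> A \<and> g \<in> A} = alg_tensor A"

definition separates_points :: "('g \<Rightarrow> complex) set \<Rightarrow> bool" where
  "separates_points A \<longleftrightarrow> (\<forall>x y. x \<noteq> y \<longrightarrow> (\<exists>f\<in>A. f x \<noteq> f y))"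

end

theory Submission
  imports Defs
begin

text \<open>
  The algebraic part rests on two observations. Elimination shows that in
  \<open>f (x + h) = (\<Sum>i<n. p i x * q i h)\<close> the functions \<open>p i\<close> and \<open>q i\<close> can be chosen in the
  linear span of translates of \<open>f\<close> (the \<open>q i\<close> cut off outside \<open>H\<close>), hence in \<open>PG\<close>; and a compactly
  supported function is a finite sum of its restrictions to cosets of \<open>H\<close>. Writing \<open>y\<close> as
  \<open>j + h\<close> on a coset then turns \<open>f (x + y) * g y\<close> into a finite tensor, and the
  substitution \<open>x = (x + y) - y\<close> gives the converse.

  Separation of points is the Peter-Weyl theorem for the compact group \<open>H\<close>. The Haar mean of a
  continuous function is the constant uniformly approximated by averages of its right
  translates. If no representative function separated \<open>h\<close> from \<open>0\<close>, then for every continuous \<open>u\<close>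
  the function \<open>f x = u (x + h) - u x\<close> would be orthogonal to all representative functions. For
  \<open>f \<noteq> 0\<close> convolution with \<open>k = f\<^sup>* * f\<close> is a nonzero symmetric operator whose kernel lies in
  this orthogonal complement; power iteration yields an eigenfunction of its square there, but
  eigenspaces are finite-dimensional and translation invariant, so the eigenfunction is itself
  representative, hence orthogonal to itself.
\<close>

section \<open>The Haar mean on a compact open subgroup\<close>

text \<open>Peter-Weyl is applied to a single compact open subgroup \<open>H\<close> and to real
  functions: a real representative function of \<open>H\<close>, extended by zero, already lies in
  \<open>PG\<close>, because \<open>H\<close> is clopen. The obstacle is that the inner product
  lives on continuous functions, which need not be complete in its norm, so limits have to be
  uniform. One more convolution achieves this: a continuous kernel turns Cauchy sequences for the
  mean-square norm into uniformly Cauchy ones. The square of the operator appears because a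
  symmetric operator can have both \<open>l\<close> and \<open>- l\<close> at the edge of its
  spectrum, and its iterates may then oscillate. The mean itself rests on comparing right averages
  with left ones. The two commute by associativity, and from this come uniqueness and right
  invariance.\<close>

lemma compact_open_subgroup_Int:
  assumes "compact_open_subgroup (H :: 'g::{t2_space, group_add} set)" "compact_open_subgroup K"
  shows "compact_open_subgroup (H \<inter> K)"
  using assms unfolding compact_open_subgroup_def
  by (auto intro: compact_Int)

text \<open>This takes the place of uniform continuity, with no metric on the domain: the set where
  the deviation from the section at \<open>x0\<close> is below \<open>e\<close> is open and contains
  \<open>{x0} \<times> K\<close>, so the tube lemma provides the neighbourhood
  \<open>U\<close>.\<close>

lemma tube_uniform:
  fixes F :: "'a::topological_space \<Rightarrow> 'b::topological_space \<Rightarrow> real"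
  assumes "compact K" "continuous_on UNIV (\<lambda>(x, y). F x y)" "0 < e"
  shows "\<exists>U. open U \<and> x0 \<in> U \<and> (\<forall>x\<in>U. \<forall>y\<in>K. \<bar>F x y - F x0 y\<bar> < e)"
proof -
  let ?W = "{z. \<bar>F (fst z) (snd z) - F x0 (snd z)\<bar> < e}"
  have c: "continuous_on UNIV (\<lambda>z. F (fst z) (snd z))"
    using assms(2) by (simp add: case_prod_unfold)
  have "continuous_on UNIV (\<lambda>z::'a\<times>'b. F x0 (snd z))"
    by (rule continuous_on_compose2[OF c, of _ "\<lambda>z. (x0, snd z)", simplified]) (intro continuous_intros)
  then have "open ?W"
    by (intro open_Collect_less continuous_intros c)
  moreover have "{x0} \<times> K \<subseteq> ?W"
    using assms(3) by auto
  ultimately obtain U where "x0 \<in> U" "open U" "U \<times> K \<subseteq> ?W"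
    using Elementary_Topology.tube_lemma[OF assms(1), of ?W x0] by blast
  then show ?thesis
    by (intro exI[of _ U]) force
qed

text \<open>One small value lowers the bound on the whole sum by \<open>d\<close>. This makes
  averaging contract the oscillation, and it makes the mean of a nonzero nonnegative function
  positive.\<close>

lemma sum_list_le_one_smaller:
  fixes v :: "'a \<Rightarrow> real" and B d :: real
  assumes "\<And>t. t \<in> set ts \<Longrightarrow> v t \<le> B" "t0 \<in> set ts" "v t0 \<le> B - d"
  shows "(\<Sum>t\<leftarrow>ts. v t) \<le> length ts * B - d"
  using assms
proof (induction ts)
  case (Cons t ts)
  have b: "v t \<le> B"
    using Cons.prems(1) by simp
  have "sum_list (map v ts) \<le> sum_list (map (\<lambda>t. B) ts)"
    by (rule sum_list_mono) (use Cons.prems(1) in simp)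
  then have all: "(\<Sum>t\<leftarrow>ts. v t) \<le> length ts * B"
    by (simp add: sum_list_triv)
  show ?case
  proof (cases "t0 \<in> set ts")
    case True
    then have "(\<Sum>t\<leftarrow>ts. v t) \<le> length ts * B - d"
      by (intro Cons.IH) (use Cons.prems in auto)
    with b show ?thesis
      by (simp add: algebra_simps)
  next
    case False
    then show ?thesis
      using Cons.prems all by (simp add: algebra_simps)
  qed
qed simp

lemma sum_list_divide: "(\<Sum>t\<leftarrow>ts. v t / c) = (\<Sum>t\<leftarrow>ts. v t) / (c :: real)"
  by (induction ts) (simp_all add: add_divide_distrib)

locale compact_open_group =
  fixes H :: "'g::{topological_group_add, t2_space} set"
  assumes subgroup: "compact_open_subgroup H"
begin

lemma compact_H: "compact H" and open_H: "open H" and zero_H [simp]: "0 \<in> H"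
  and add_H: "x \<in> H \<Longrightarrow> y \<in> H \<Longrightarrow> x + y \<in> H" and minus_H: "x \<in> H \<Longrightarrow> - x \<in> H"
  using subgroup by (auto simp: compact_open_subgroup_def)

lemma minus_H_iff [simp]: "- x \<in> H \<longleftrightarrow> x \<in> H"
  using minus_H[of x] minus_H[of "- x"] by auto

lemma add_H_left_iff [simp]: "h \<in> H \<Longrightarrow> h + x \<in> H \<longleftrightarrow> x \<in> H"
  using add_H[of "- h" "h + x"] add_H[of h x] by (auto simp: add.assoc[symmetric])

lemma add_H_right_iff [simp]: "h \<in> H \<Longrightarrow> x + h \<in> H \<longleftrightarrow> x \<in> H"
  using add_H[of "x + h" "- h"] add_H[of x h] by (auto simp: add.assoc)

lemma H_nonempty: "H \<noteq> {}"
  using zero_H by blast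

lemma closed_H: "closed H"
  by (rule compact_imp_closed[OF compact_H])

lemma continuous_cutoff:
  fixes f :: "'g \<Rightarrow> 'b::{topological_space, zero}"
  assumes "continuous_on H f"
  shows "continuous_on UNIV (\<lambda>x. if x \<in> H then f x else 0)"
proof -
  have "continuous_on (H \<union> - H) (\<lambda>x. if x \<in> H then f x else 0)"
    by (rule continuous_on_If) (use assms closed_H open_H in auto)
  then show ?thesis by simp
qed

text \<open>This is the real space C(H), each function being extended by zero, which keeps it
  continuous because \<open>H\<close> is clopen. Members that agree on \<open>H\<close> are equal,
  so operators can act on plain functions on the group.\<close>

definition CH :: "('g \<Rightarrow> real) set" where
  "CH = {f. continuous_on UNIV f \<and> (\<forall>x. x \<notin> H \<longrightarrow> f x = 0)}"

lemma CH_continuous: "f \<in> CH \<Longrightarrow> continuous_on UNIV f"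
  and CH_outside: "f \<in> CH \<Longrightarrow> x \<notin> H \<Longrightarrow> f x = 0"
  by (auto simp: CH_def)

lemma CH_compose: "f \<in> CH \<Longrightarrow> continuous_on S g \<Longrightarrow> continuous_on S (\<lambda>x. f (g x))"
  by (rule continuous_on_compose2[OF CH_continuous]) auto

lemma CH_zero: "(\<lambda>x. 0) \<in> CH"
  and CH_add: "f \<in> CH \<Longrightarrow> g \<in> CH \<Longrightarrow> (\<lambda>x. f x + g x) \<in> CH"
  and CH_diff: "f \<in> CH \<Longrightarrow> g \<in> CH \<Longrightarrow> (\<lambda>x. f x - g x) \<in> CH"
  and CH_cmult: "f \<in> CH \<Longrightarrow> (\<lambda>x. c * f x) \<in> CH"
  and CH_mult: "f \<in> CH \<Longrightarrow> g \<in> CH \<Longrightarrow> (\<lambda>x. f x * g x) \<in> CH"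
  and CH_divide: "f \<in> CH \<Longrightarrow> (\<lambda>x. f x / c) \<in> CH"
  by (auto simp: CH_def divide_inverse intro!: continuous_intros)

lemma CH_sum: "(\<And>i. i \<in> I \<Longrightarrow> f i \<in> CH) \<Longrightarrow> (\<lambda>x. \<Sum>i\<in>I. f i x) \<in> CH"
  by (auto simp: CH_def intro!: continuous_intros)

lemma CH_sum_list: "(\<And>i. i \<in> set I \<Longrightarrow> f i \<in> CH) \<Longrightarrow> (\<lambda>x. \<Sum>i\<leftarrow>I. f i x) \<in> CH"
  by (induction I) (auto intro: CH_zero CH_add)

lemma CH_left: "f \<in> CH \<Longrightarrow> a \<in> H \<Longrightarrow> (\<lambda>x. f (a + x)) \<in> CH"
  and CH_right: "f \<in> CH \<Longrightarrow> a \<in> H \<Longrightarrow> (\<lambda>x. f (x + a)) \<in> CH"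
  and CH_minus: "f \<in> CH \<Longrightarrow> (\<lambda>x. f (- x)) \<in> CH"
  by (auto simp: CH_def CH_compose intro!: continuous_on_compose2[of UNIV f] continuous_intros)

lemma CH_const: "(\<lambda>x. if x \<in> H then c else 0) \<in> CH"
  by (auto simp: CH_def intro!: continuous_cutoff)

lemma CH_bounded: "f \<in> CH \<Longrightarrow> \<exists>B>0. \<forall>x. \<bar>f x\<bar> \<le> B"
proof -
  assume f: "f \<in> CH"
  have "compact (f ` H)"
    using compact_continuous_image[OF continuous_on_subset[OF CH_continuous[OF f]] compact_H] by simp
  then have "bounded (f ` H)"
    by (rule compact_imp_bounded)
  then obtain B where "\<forall>x\<in>H. \<bar>f x\<bar> \<le> B"
    by (auto simp: bounded_iff)
  then have "\<forall>x. \<bar>f x\<bar> \<le> max B 1"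
    using CH_outside[OF f] by (metis abs_zero le_max_iff_disj zero_le_one)
  then show ?thesis
    by (intro exI[of _ "max B 1"]) auto
qed

section \<open>Finite averages over right and left translates\<close>

text \<open>Translations form lists, not sets: repetitions act as weights, so an average of averages
  is again an average over a single list (\<open>ravg_ravg\<close>).\<close>

definition ravg :: "'g list \<Rightarrow> ('g \<Rightarrow> real) \<Rightarrow> 'g \<Rightarrow> real" where
  "ravg as f x = (\<Sum>a\<leftarrow>as. f (x + a)) / length as"

definition lavg :: "'g list \<Rightarrow> ('g \<Rightarrow> real) \<Rightarrow> 'g \<Rightarrow> real" where
  "lavg as f x = (\<Sum>a\<leftarrow>as. f (a + x)) / length as"

definition index_list :: "'g list \<Rightarrow> bool" where
  "index_list as \<longleftrightarrow> as \<noteq> [] \<and> set as \<subseteq> H"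

lemma ravg_CH: "index_list as \<Longrightarrow> f \<in> CH \<Longrightarrow> ravg as f \<in> CH"
  by (auto simp: ravg_def[abs_def] index_list_def intro!: CH_divide CH_sum_list CH_right)

lemma ravg_add: "ravg as (\<lambda>x. f x + g x) x = ravg as f x + ravg as g x"
  by (simp add: ravg_def sum_list_addf add_divide_distrib)

lemma ravg_cmult: "ravg as (\<lambda>x. c * f x) x = c * ravg as f x"
  by (simp add: ravg_def sum_list_const_mult)

lemma ravg_left: "ravg as (\<lambda>x. f (b + x)) x = ravg as f (b + x)"
  by (simp add: ravg_def add.assoc)

lemma ravg_mono:
  assumes "index_list as" "\<And>x. x \<in> H \<Longrightarrow> f x \<le> g x" "x \<in> H"
  shows "ravg as f x \<le> ravg as g x"
  using assms by (auto simp: ravg_def index_list_def intro!: divide_right_mono sum_list_mono)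

lemma ravg_const:
  assumes "index_list as" "\<And>x. x \<in> H \<Longrightarrow> f x = c" "x \<in> H"
  shows "ravg as f x = c"
proof -
  have "(\<Sum>a\<leftarrow>as. f (x + a)) = (\<Sum>a\<leftarrow>as. c)"
    using assms by (intro arg_cong[of _ _ sum_list] map_cong) (auto simp: index_list_def)
  then show ?thesis
    using assms by (simp add: ravg_def sum_list_triv index_list_def)
qed

lemma ravg_le:
  assumes "index_list as" "\<And>x. x \<in> H \<Longrightarrow> f x \<le> c" "x \<in> H"
  shows "ravg as f x \<le> c"
  using ravg_mono[OF assms(1), of f "\<lambda>_. c" x] ravg_const[OF assms(1), of "\<lambda>_. c" c x] assms by auto

lemma ravg_ge:
  assumes "index_list as" "\<And>x. x \<in> H \<Longrightarrow> c \<le> f x" "x \<in> H"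
  shows "c \<le> ravg as f x"
  using ravg_mono[OF assms(1), of "\<lambda>_. c" f x] ravg_const[OF assms(1), of "\<lambda>_. c" c x] assms by auto

lemma ravg_near:
  assumes "index_list as" "\<And>x. x \<in> H \<Longrightarrow> \<bar>f x - c\<bar> \<le> e" "x \<in> H"
  shows "\<bar>ravg as f x - c\<bar> \<le> e"
proof -
  have "c - e \<le> f x" "f x \<le> c + e" if "x \<in> H" for x
    using assms(2)[OF that] by auto
  then have "c - e \<le> ravg as f x" "ravg as f x \<le> c + e"
    using ravg_le[OF assms(1), of f "c + e" x] ravg_ge[OF assms(1), of "c - e" f x] assms(3) by auto
  then show ?thesis by auto
qed

lemma ravg_diff_le:
  assumes "index_list as" "\<And>x. x \<in> H \<Longrightarrow> \<bar>f x - g x\<bar> \<le> e" "x \<in> H"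
  shows "\<bar>ravg as f x - ravg as g x\<bar> \<le> e"
proof -
  have "\<bar>ravg as (\<lambda>x. f x + (-1) * g x) x - 0\<bar> \<le> e"
    by (rule ravg_near) (use assms in auto)
  then show ?thesis
    unfolding ravg_add ravg_cmult by simp
qed

lemma lavg_eq_ravg: "lavg as f x = ravg (map uminus as) (\<lambda>x. f (- x)) (- x)"
  by (simp add: lavg_def ravg_def comp_def minus_add)

lemma index_list_uminus [simp]: "index_list (map uminus as) \<longleftrightarrow> index_list as"
  by (auto simp: index_list_def)

lemma lavg_near:
  assumes "index_list as" "\<And>x. x \<in> H \<Longrightarrow> \<bar>f x - c\<bar> \<le> e" "x \<in> H"
  shows "\<bar>lavg as f x - c\<bar> \<le> e"
  unfolding lavg_eq_ravg by (rule ravg_near) (use assms in auto)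

text \<open>Left and right translations commute by associativity. Comparing the two orders of
  averaging gives the uniqueness of the mean and its right invariance.\<close>

lemma ravg_lavg: "ravg as (lavg bs f) x = lavg bs (ravg as f) x"
proof -
  have "(\<Sum>a\<leftarrow>as. \<Sum>b\<leftarrow>bs. f (b + (x + a))) = (\<Sum>b\<leftarrow>bs. \<Sum>a\<leftarrow>as. f (b + x + a))"
    by (induction as) (simp_all add: sum_list_addf add.assoc)
  then show ?thesis
    by (simp add: ravg_def lavg_def sum_list_divide mult.commute)
qed

definition compose_list :: "'g list \<Rightarrow> 'g list \<Rightarrow> 'g list" where
  "compose_list as bs = concat (map (\<lambda>a. map ((+) a) bs) as)"

lemma length_compose_list: "length (compose_list as bs) = length as * length bs"
  by (induction as) (auto simp: compose_list_def)

lemma index_compose_list: "index_list as \<Longrightarrow> index_list bs \<Longrightarrow> index_list (compose_list as bs)"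
  by (cases as) (auto simp: index_list_def compose_list_def add_H subset_iff)

lemma ravg_ravg: "ravg as (ravg bs f) = ravg (compose_list as bs) f"
proof
  fix x
  have "(\<Sum>c\<leftarrow>compose_list as bs. f (x + c)) = (\<Sum>a\<leftarrow>as. \<Sum>b\<leftarrow>bs. f (x + a + b))"
    by (induction as) (auto simp: compose_list_def comp_def add.assoc)
  then show "ravg as (ravg bs f) x = ravg (compose_list as bs) f x"
    by (simp add: ravg_def length_compose_list sum_list_divide mult.commute)
qed

text \<open>The list \<open>ts\<close> of translations depends only on the modulus of continuity of \<open>f\<close>,
  which all averages of \<open>f\<close> inherit; so each round shrinks the excess of the
  oscillation over \<open>e\<close> by the same factor.\<close>

lemma ravg_oscillation:
  assumes f: "f \<in> CH" and e: "0 < e"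
  shows "\<exists>as c. index_list as \<and> (\<forall>x\<in>H. \<bar>ravg as f x - c\<bar> \<le> e)"
proof -
  \<comment> \<open>Half of \<open>e\<close> pays for the modulus of continuity, the other half for
    the geometrically shrinking excess.\<close>
  define d where "d = e / 2"
  have d: "0 < d" using e by (simp add: d_def)
  have "continuous_on UNIV (\<lambda>(u, x). f (u + x))"
    unfolding case_prod_unfold by (rule CH_compose[OF f]) (intro continuous_intros)
  from tube_uniform[OF compact_H this d, of 0]
  obtain U where U: "open U" "0 \<in> U" "\<And>u x. u \<in> U \<Longrightarrow> x \<in> H \<Longrightarrow> \<bar>f (u + x) - f x\<bar> < d"
    by auto
  have U': "\<bar>ravg as f (u + x) - ravg as f x\<bar> \<le> d" if "index_list as" "u \<in> U" "x \<in> H" for as u x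
  proof -
    have "\<bar>ravg as (\<lambda>x. f (u + x)) x - ravg as f x\<bar> \<le> d"
      using U(3)[OF that(2)] that by (intro ravg_diff_le) (auto intro: less_imp_le)
    then show ?thesis
      by (simp add: ravg_left)
  qed
  have "open {x. x + t \<in> U}" for t
    by (rule open_vimage[OF U(1), of "\<lambda>x. x + t", unfolded vimage_def]) (intro continuous_intros)
  \<comment> \<open>The translation by \<open>- x\<close> moves \<open>x\<close> to
    \<open>0\<close>, which lies in \<open>U\<close>.\<close>
  moreover have "H \<subseteq> (\<Union>t\<in>H. {x. x + t \<in> U})"
    using U(2) minus_H by (force intro: bexI[of _ "- _"])
  ultimately obtain T where T: "T \<subseteq> H" "finite T" "H \<subseteq> (\<Union>t\<in>T. {x. x + t \<in> U})"
    using compactE_image[OF compact_H, of H "\<lambda>t. {x. x + t \<in> U}"] by metis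
  obtain ts where ts: "set ts = T"
    using T(2) finite_list by blast
  have tsi: "index_list ts"
    using T ts H_nonempty by (auto simp: index_list_def)
  define n where "n = real (length ts)"
  have n: "n \<ge> 1"
    using tsi by (cases ts) (auto simp: n_def index_list_def)
  \<comment> \<open>Among \<open>n\<close> sampled values one lies below the upper bound by the full
    excess \<open>D\<close>, so the average lies below it by \<open>D / n\<close>.\<close>
  define q where "q = 1 - 1 / n"
  have q: "0 \<le> q" "q < 1"
    using n by (auto simp: q_def)
  obtain B where B: "B > 0" "\<And>x. \<bar>f x\<bar> \<le> B"
    using CH_bounded[OF f] by blast
  have "\<exists>as m. index_list as \<and> (\<forall>x\<in>H. m \<le> ravg as f x \<and> ravg as f x \<le> m + (d + q ^ k * (2 * B)))" for k
  proof (induction k)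
    case 0
    have "ravg [0] f = f"
      by (simp add: ravg_def[abs_def])
    moreover have "- B \<le> f x \<and> f x \<le> - B + (d + 2 * B)" for x
      using B(2)[of x] d by auto
    ultimately show ?case
      by (intro exI[of _ "[0]"] exI[of _ "- B"]) (auto simp: index_list_def)
  next
    case (Suc k)
    then obtain as m where as: "index_list as"
      and m: "\<And>x. x \<in> H \<Longrightarrow> m \<le> ravg as f x \<and> ravg as f x \<le> m + (d + q ^ k * (2 * B))"
      by blast
    define D where "D = q ^ k * (2 * B)"
    let ?g = "ravg as f"
    have g: "?g \<in> CH" by (rule ravg_CH[OF as f])
    obtain x0 where x0: "x0 \<in> H" "\<And>x. x \<in> H \<Longrightarrow> ?g x0 \<le> ?g x"
      using continuous_attains_inf[OF compact_H _ continuous_on_subset[OF CH_continuous[OF g]]] zero_H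
      by (metis empty_iff top_greatest)
    \<comment> \<open>For every \<open>x\<close> in \<open>H\<close> some \<open>x + t\<close> lies
      in \<open>U\<close>. Adding the minimum point \<open>x0\<close> puts the sample
      \<open>x + (t + x0)\<close> into \<open>U + x0\<close>, where \<open>?g\<close> exceeds its
      minimum by at most \<open>d\<close>.\<close>
    let ?bs = "map (\<lambda>t. t + x0) ts"
    have bs: "index_list ?bs"
      using tsi x0(1) by (auto simp: index_list_def)
    have up: "ravg ?bs ?g x \<le> ?g x0 + (d + q * D)" if x: "x \<in> H" for x
    proof -
      obtain t where t: "t \<in> set ts" "x + t \<in> U"
        using T(3) x ts by auto
      have "?g (x + (t + x0)) \<le> (?g x0 + (d + D)) - D"
        using U'[OF as t(2) x0(1)] by (auto simp: add.assoc)
      moreover have "?g (x + (s + x0)) \<le> ?g x0 + (d + D)" if "s \<in> set ts" for s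
      proof -
        have "x + (s + x0) \<in> H"
          using x x0 that tsi by (auto simp: index_list_def)
        then show ?thesis
          using m[of "x + (s + x0)"] m[of x0] x0(1) unfolding D_def by linarith
      qed
      ultimately have "(\<Sum>s\<leftarrow>ts. ?g (x + (s + x0))) \<le> n * (?g x0 + (d + D)) - D"
        unfolding n_def using sum_list_le_one_smaller[of ts "\<lambda>s. ?g (x + (s + x0))" "?g x0 + (d + D)" t D] t(1)
        by blast
      then have "ravg ?bs ?g x \<le> (n * (?g x0 + (d + D)) - D) / n"
        unfolding ravg_def[of ?bs] using n by (auto simp: n_def comp_def intro!: divide_right_mono)
      also have "\<dots> = ?g x0 + (d + q * D)"
        using n by (simp add: q_def field_simps)
      finally show ?thesis .
    qed
    have "?g x0 \<le> ravg ?bs ?g x" if "x \<in> H" for x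
      by (rule ravg_ge[OF bs x0(2) that])
    with up show ?case
      using index_compose_list[OF bs as]
      by (intro exI[of _ "compose_list ?bs as"] exI[of _ "?g x0"]) (auto simp: ravg_ravg D_def mult.assoc)
  qed note step = this
  have "(\<lambda>k. q ^ k * (2 * B)) \<longlonglongrightarrow> 0 * (2 * B)"
    by (intro tendsto_intros LIMSEQ_power_zero) (use q in auto)
  then have "\<forall>\<^sub>F k in sequentially. q ^ k * (2 * B) < d"
    using d by (auto dest: order_tendstoD(2))
  then obtain k where k: "q ^ k * (2 * B) < d"
    by (auto simp: eventually_sequentially)
  obtain as m where as: "index_list as"
    and m: "\<And>x. x \<in> H \<Longrightarrow> m \<le> ravg as f x \<and> ravg as f x \<le> m + (d + q ^ k * (2 * B))"
    using step[of k] by blast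
  have "\<bar>ravg as f x - m\<bar> \<le> e" if "x \<in> H" for x
    using m[OF that] k by (auto simp: d_def)
  with as show ?thesis by blast
qed

section \<open>Existence and uniqueness of the mean\<close>

definition rmean :: "('g \<Rightarrow> real) \<Rightarrow> real \<Rightarrow> bool" where
  "rmean f c \<longleftrightarrow> (\<forall>e>0. \<exists>as. index_list as \<and> (\<forall>x\<in>H. \<bar>ravg as f x - c\<bar> \<le> e))"

definition lmean :: "('g \<Rightarrow> real) \<Rightarrow> real \<Rightarrow> bool" where
  "lmean f c \<longleftrightarrow> (\<forall>e>0. \<exists>as. index_list as \<and> (\<forall>x\<in>H. \<bar>lavg as f x - c\<bar> \<le> e))"

lemma lmean_iff_rmean: "lmean f c \<longleftrightarrow> rmean (\<lambda>x. f (- x)) c"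
proof -
  have eq: "(\<forall>x\<in>H. \<bar>ravg as (\<lambda>x. f (- x)) (- x) - c\<bar> \<le> e) \<longleftrightarrow>
    (\<forall>x\<in>H. \<bar>ravg as (\<lambda>x. f (- x)) x - c\<bar> \<le> e)" for as e
    by (metis minus_H minus_minus)
  have ex: "(\<exists>as. index_list as \<and> P (map uminus as)) \<longleftrightarrow> (\<exists>as. index_list as \<and> P as)" for P
  proof safe
    fix as assume "index_list as" "P as"
    then show "\<exists>as. index_list as \<and> P (map uminus as)"
      by (intro exI[of _ "map uminus as"]) (simp add: comp_def)
  qed (use index_list_uminus in blast)
  show ?thesis
    unfolding lmean_def rmean_def lavg_eq_ravg eq
    using ex[of "\<lambda>as. \<forall>x\<in>H. \<bar>ravg as (\<lambda>x. f (- x)) x - c\<bar> \<le> _"] by simp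
qed

text \<open>Averaging keeps a nearly constant function near the same constant, so the two-sided
  average of \<open>f\<close> at \<open>0\<close> is close to both \<open>c\<close> and
  \<open>c'\<close>.\<close>

lemma ravg_lavg_near:
  assumes "index_list as" "\<And>x. x \<in> H \<Longrightarrow> \<bar>ravg as f x - c\<bar> \<le> d"
    and "index_list bs" "\<And>x. x \<in> H \<Longrightarrow> \<bar>lavg bs f x - c'\<bar> \<le> e"
  shows "\<bar>c - c'\<bar> \<le> d + e"
proof -
  have "\<bar>lavg bs (ravg as f) 0 - c\<bar> \<le> d" "\<bar>ravg as (lavg bs f) 0 - c'\<bar> \<le> e"
    using lavg_near[OF assms(3), of "ravg as f" c d 0] ravg_near[OF assms(1), of "lavg bs f" c' e 0] assms
    by auto
  then show ?thesis
    unfolding ravg_lavg by linarith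
qed

lemma rmean_lmean_unique:
  assumes "rmean f c" "lmean f c'"
  shows "c = c'"
proof -
  have "\<bar>c - c'\<bar> \<le> e" if e: "e > 0" for e
  proof -
    obtain as bs where "index_list as" "\<forall>x\<in>H. \<bar>ravg as f x - c\<bar> \<le> e / 2"
      "index_list bs" "\<forall>x\<in>H. \<bar>lavg bs f x - c'\<bar> \<le> e / 2"
      using assms e unfolding rmean_def lmean_def by (meson half_gt_zero)
    then show ?thesis
      using ravg_lavg_near[of as f c "e / 2" bs c' "e / 2"] by auto
  qed
  then show ?thesis
    using field_le_epsilon[of "\<bar>c - c'\<bar>" 0] by simp
qed

text \<open>\<open>ravg_oscillation\<close> yields a constant that may vary with the tolerance. The
  supremum of all lower bounds of right averages is a choice independent of it; left averages bound
  it from above, since a two-sided average can be compared with both.\<close>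

lemma rmean_exists:
  assumes f: "f \<in> CH"
  shows "\<exists>c. rmean f c"
proof -
  have R: "\<exists>as c. index_list as \<and> (\<forall>x\<in>H. \<bar>ravg as f x - c\<bar> \<le> e)" if "e > 0" for e
    by (rule ravg_oscillation[OF f that])
  have L: "\<exists>as c. index_list as \<and> (\<forall>x\<in>H. \<bar>lavg as f x - c\<bar> \<le> e)" if e: "e > 0" for e
  proof -
    obtain as c where "index_list as" "\<forall>x\<in>H. \<bar>ravg as (\<lambda>x. f (- x)) x - c\<bar> \<le> e"
      using ravg_oscillation[OF CH_minus[OF f] e] by blast
    then show ?thesis
      by (intro exI[of _ "map uminus as"] exI[of _ c]) (simp add: lavg_eq_ravg comp_def)
  qed
  define S where "S = {l. \<exists>as. index_list as \<and> (\<forall>x\<in>H. l \<le> ravg as f x)}"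
  have up: "l \<le> c + e" if l: "l \<in> S" and "index_list bs" "\<forall>x\<in>H. \<bar>lavg bs f x - c\<bar> \<le> e" for l bs c e
  proof -
    obtain as where as: "index_list as" "\<forall>x\<in>H. l \<le> ravg as f x"
      using l by (auto simp: S_def)
    have "l \<le> ravg (map uminus bs) (\<lambda>x. ravg as f (- x)) (- 0)"
      by (rule ravg_ge) (use as that in auto)
    also have "\<dots> = ravg as (lavg bs f) 0"
      unfolding ravg_lavg lavg_eq_ravg ..
    also have "\<dots> \<le> c + e"
      using that as by (intro ravg_le) (auto simp: abs_le_iff)
    finally show ?thesis .
  qed
  have bdd: "bdd_above S"
  proof -
    obtain bs c where "index_list bs" "\<forall>x\<in>H. \<bar>lavg bs f x - c\<bar> \<le> 1"
      using L[of 1] by auto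
    then show ?thesis
      using up by (intro bdd_aboveI[of _ "c + 1"]) blast
  qed
  have "rmean f (Sup S)"
    unfolding rmean_def
  proof (intro allI impI)
    fix e :: real assume e: "e > 0"
    \<comment> \<open>The constants \<open>c\<close> and \<open>c'\<close> may differ by two
      quarters of \<open>e\<close>; the upper bound on \<open>Sup S\<close> and the approximation by
      \<open>c\<close> use one quarter each.\<close>
    then have e4: "e / 4 > 0" by simp
    obtain as c where as: "index_list as" "\<forall>x\<in>H. \<bar>ravg as f x - c\<bar> \<le> e / 4"
      using R[OF e4] by blast
    obtain bs c' where bs: "index_list bs" "\<forall>x\<in>H. \<bar>lavg bs f x - c'\<bar> \<le> e / 4"
      using L[OF e4] by blast
    have cc: "\<bar>c - c'\<bar> \<le> e / 4 + e / 4"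
      using ravg_lavg_near[of as f c "e / 4" bs c' "e / 4"] as bs by auto
    have mem: "c - e / 4 \<in> S"
    proof -
      have "c - e / 4 \<le> ravg as f x" if "x \<in> H" for x
        using bspec[OF as(2) that] by linarith
      with as(1) show ?thesis
        unfolding S_def by blast
    qed
    then have 1: "c - e / 4 \<le> Sup S"
      using bdd by (rule cSup_upper)
    have 2: "Sup S \<le> c' + e / 4"
      using mem by (intro cSup_least) (use up bs in auto)
    have "\<bar>ravg as f x - Sup S\<bar> \<le> e" if "x \<in> H" for x
      using bspec[OF as(2) that] 1 2 cc by linarith
    then show "\<exists>as. index_list as \<and> (\<forall>x\<in>H. \<bar>ravg as f x - Sup S\<bar> \<le> e)"
      using as(1) by blast
  qed
  then show ?thesis ..
qed

lemma lmean_exists: "f \<in> CH \<Longrightarrow> \<exists>c. lmean f c"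
  using rmean_exists[OF CH_minus] by (simp add: lmean_iff_rmean)

text \<open>On \<open>CH\<close> this is the normalised Haar integral over \<open>H\<close>; outside
  \<open>CH\<close> nothing is claimed about its value.\<close>

definition mean :: "('g \<Rightarrow> real) \<Rightarrow> real" where
  "mean f = (THE c. rmean f c)"

lemma mean_eqI_r: "f \<in> CH \<Longrightarrow> rmean f c \<Longrightarrow> mean f = c"
  unfolding mean_def using lmean_exists rmean_lmean_unique by (metis the_equality)

lemma rmean_mean: "f \<in> CH \<Longrightarrow> rmean f (mean f)"
  using rmean_exists mean_eqI_r by metis

lemma lmean_mean: "f \<in> CH \<Longrightarrow> lmean f (mean f)"
  using lmean_exists rmean_lmean_unique rmean_mean by metis

lemma mean_eqI_l: "f \<in> CH \<Longrightarrow> lmean f c \<Longrightarrow> mean f = c"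
  using rmean_lmean_unique rmean_mean by metis

section \<open>Invariance, linearity and positivity of the mean\<close>

text \<open>A left translation commutes with right averages and only permutes the points of
  \<open>H\<close> at which they are tested.\<close>

lemma mean_left:
  assumes f: "f \<in> CH" and a: "a \<in> H"
  shows "mean (\<lambda>x. f (a + x)) = mean f"
proof (rule mean_eqI_r[OF CH_left[OF assms]])
  show "rmean (\<lambda>x. f (a + x)) (mean f)"
    using rmean_mean[OF f] a unfolding rmean_def ravg_left by (metis add_H)
qed

text \<open>For one-element lists this is right invariance. It comes from the left averages: they
  commute with \<open>ravg as\<close>, so they stay near the same constant after it is
  applied.\<close>

lemma mean_ravg:
  assumes f: "f \<in> CH" and as: "index_list as"
  shows "mean (ravg as f) = mean f"
proof (rule mean_eqI_l[OF ravg_CH[OF as f]])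
  show "lmean (ravg as f) (mean f)"
    unfolding lmean_def
  proof (intro allI impI)
    fix e :: real assume "e > 0"
    then obtain bs where bs: "index_list bs" "\<forall>x\<in>H. \<bar>lavg bs f x - mean f\<bar> \<le> e"
      using lmean_mean[OF f] unfolding lmean_def by blast
    then have "\<bar>lavg bs (ravg as f) x - mean f\<bar> \<le> e" if "x \<in> H" for x
      unfolding ravg_lavg[symmetric] using as that by (intro ravg_near) auto
    with bs show "\<exists>bs. index_list bs \<and> (\<forall>x\<in>H. \<bar>lavg bs (ravg as f) x - mean f\<bar> \<le> e)"
      by blast
  qed
qed

text \<open>A further average keeps a function near its mean and, by \<open>mean_ravg\<close>,
  changes no mean, so the lists can be composed one function at a time.\<close>

lemma ravg_simultaneous:
  assumes "finite F" "F \<subseteq> CH" "e > 0"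
  shows "\<exists>as. index_list as \<and> (\<forall>f\<in>F. \<forall>x\<in>H. \<bar>ravg as f x - mean f\<bar> \<le> e)"
  using assms(1,2)
proof (induction F)
  case empty
  have "index_list [0]" by (simp add: index_list_def)
  then show ?case by blast
next
  case (insert f F)
  then obtain as where as: "index_list as" "\<forall>f\<in>F. \<forall>x\<in>H. \<bar>ravg as f x - mean f\<bar> \<le> e"
    by auto
  have f: "f \<in> CH" using insert by auto
  have "rmean (ravg as f) (mean f)"
    using rmean_mean[OF ravg_CH[OF as(1) f]] mean_ravg[OF f as(1)] by simp
  then obtain bs where bs: "index_list bs" "\<forall>x\<in>H. \<bar>ravg bs (ravg as f) x - mean f\<bar> \<le> e"
    using assms(3) unfolding rmean_def by blast
  have "\<bar>ravg bs (ravg as g) x - mean g\<bar> \<le> e" if "g \<in> insert f F" "x \<in> H" for g x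
    by (cases "g = f") (use that as bs ravg_near[OF bs(1), of "ravg as g" "mean g" e x] in auto)
  then show ?case
    using index_compose_list[OF bs(1) as(1)] unfolding ravg_ravg by blast
qed

lemma mean_add:
  assumes f: "f \<in> CH" and g: "g \<in> CH"
  shows "mean (\<lambda>x. f x + g x) = mean f + mean g"
proof (rule mean_eqI_r[OF CH_add[OF assms]])
  show "rmean (\<lambda>x. f x + g x) (mean f + mean g)"
    unfolding rmean_def
  proof (intro allI impI)
    fix e :: real assume "e > 0"
    then have "e / 2 > 0" by simp
    from ravg_simultaneous[OF _ _ this, of "{f, g}"] f g
    obtain as where as: "index_list as" "\<forall>f\<in>{f, g}. \<forall>x\<in>H. \<bar>ravg as f x - mean f\<bar> \<le> e / 2"
      by auto
    have "\<bar>ravg as (\<lambda>x. f x + g x) x - (mean f + mean g)\<bar> \<le> e" if "x \<in> H" for x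
    proof -
      have "\<bar>ravg as f x - mean f\<bar> \<le> e / 2" "\<bar>ravg as g x - mean g\<bar> \<le> e / 2"
        using as(2) that by auto
      then show ?thesis
        unfolding ravg_add by linarith
    qed
    with as(1) show "\<exists>as. index_list as \<and> (\<forall>x\<in>H. \<bar>ravg as (\<lambda>x. f x + g x) x - (mean f + mean g)\<bar> \<le> e)"
      by blast
  qed
qed

lemma mean_bounds:
  assumes f: "f \<in> CH" and b: "\<And>x. x \<in> H \<Longrightarrow> l \<le> f x" "\<And>x. x \<in> H \<Longrightarrow> f x \<le> u"
  shows "l \<le> mean f" "mean f \<le> u"
proof -
  have "l \<le> mean f + e \<and> mean f \<le> u + e" if e: "e > 0" for e
  proof -
    obtain as where as: "index_list as" "\<forall>x\<in>H. \<bar>ravg as f x - mean f\<bar> \<le> e"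
      using rmean_mean[OF f] e unfolding rmean_def by blast
    have "l \<le> ravg as f 0" "ravg as f 0 \<le> u" "\<bar>ravg as f 0 - mean f\<bar> \<le> e"
      using ravg_ge[OF as(1) b(1)] ravg_le[OF as(1) b(2)] as(2) by auto
    then show ?thesis by linarith
  qed
  then show "l \<le> mean f" "mean f \<le> u"
    by (auto intro: field_le_epsilon)
qed

lemma mean_zero [simp]: "mean (\<lambda>x. 0) = 0"
  using mean_bounds[OF CH_zero, of 0 0] by simp

lemma mean_cmult:
  assumes f: "f \<in> CH"
  shows "mean (\<lambda>x. c * f x) = c * mean f"
proof (rule mean_eqI_r[OF CH_cmult[OF assms]])
  show "rmean (\<lambda>x. c * f x) (c * mean f)"
    unfolding rmean_def
  proof (intro allI impI)
    fix e :: real assume e: "e > 0"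
    \<comment> \<open>The summand \<open>1\<close> covers the case \<open>c = 0\<close>.\<close>
    then have e': "e / (\<bar>c\<bar> + 1) > 0" by (simp add: add_nonneg_pos)
    obtain as where as: "index_list as" "\<forall>x\<in>H. \<bar>ravg as f x - mean f\<bar> \<le> e / (\<bar>c\<bar> + 1)"
      using rmean_mean[OF f] e' unfolding rmean_def by blast
    have "\<bar>ravg as (\<lambda>x. c * f x) x - c * mean f\<bar> \<le> e" if "x \<in> H" for x
    proof -
      have "\<bar>ravg as (\<lambda>x. c * f x) x - c * mean f\<bar> = \<bar>c\<bar> * \<bar>ravg as f x - mean f\<bar>"
        by (simp add: ravg_cmult right_diff_distrib[symmetric] abs_mult)
      also have "\<dots> \<le> (\<bar>c\<bar> + 1) * (e / (\<bar>c\<bar> + 1))"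
        using as(2) that by (intro mult_mono) auto
      also have "\<dots> = e" by (simp add: field_simps)
      finally show ?thesis .
    qed
    with as(1) show "\<exists>as. index_list as \<and> (\<forall>x\<in>H. \<bar>ravg as (\<lambda>x. c * f x) x - c * mean f\<bar> \<le> e)"
      by blast
  qed
qed

lemma mean_diff: "f \<in> CH \<Longrightarrow> g \<in> CH \<Longrightarrow> mean (\<lambda>x. f x - g x) = mean f - mean g"
  using mean_add[of f "\<lambda>x. (-1) * g x"] mean_cmult[of g "-1"] CH_cmult[of g "-1"] by simp

lemma mean_sum:
  "(\<And>i. i \<in> I \<Longrightarrow> f i \<in> CH) \<Longrightarrow> mean (\<lambda>x. \<Sum>i\<in>I. f i x) = (\<Sum>i\<in>I. mean (f i))"
  by (induction I rule: infinite_finite_induct) (simp_all add: mean_add CH_sum)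

lemma mean_nonneg: "f \<in> CH \<Longrightarrow> (\<And>x. x \<in> H \<Longrightarrow> 0 \<le> f x) \<Longrightarrow> 0 \<le> mean f"
  using mean_bounds(1)[of f 0] CH_bounded[of f] by (metis abs_le_D1)

lemma mean_abs_le:
  assumes "f \<in> CH" "\<And>x. x \<in> H \<Longrightarrow> \<bar>f x\<bar> \<le> e"
  shows "\<bar>mean f\<bar> \<le> e"
proof -
  have "- e \<le> f x" "f x \<le> e" if "x \<in> H" for x
    using assms(2)[OF that] by auto
  then show ?thesis
    using mean_bounds[OF assms(1), of "- e" e] by (auto simp: abs_le_iff)
qed

lemma mean_diff_le:
  assumes "f \<in> CH" "g \<in> CH" "\<And>x. x \<in> H \<Longrightarrow> \<bar>f x - g x\<bar> \<le> e"
  shows "\<bar>mean f - mean g\<bar> \<le> e"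
  using mean_abs_le[OF CH_diff[OF assms(1,2)], of e] assms by (simp add: mean_diff)

text \<open>Finitely many right translates of the open set where \<open>f\<close> exceeds half of
  \<open>f x0\<close> cover \<open>H\<close>. The corresponding average of \<open>f\<close> is
  bounded below on \<open>H\<close> by a positive constant and has the same mean as
  \<open>f\<close>.\<close>

lemma mean_pos:
  assumes f: "f \<in> CH" and nn: "\<And>x. x \<in> H \<Longrightarrow> 0 \<le> f x" and x0: "f x0 > 0"
  shows "mean f > 0"
proof -
  define U where "U = {x. f x > f x0 / 2}"
  have oU: "open U"
    unfolding U_def by (intro open_Collect_less continuous_intros CH_continuous[OF f])
  have x0H: "x0 \<in> H" using x0 CH_outside[OF f, of x0] by auto
  have "open {x. x + t \<in> U}" for t
    by (rule open_vimage[OF oU, of "\<lambda>x. x + t", unfolded vimage_def]) (intro continuous_intros)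
  moreover have "H \<subseteq> (\<Union>t\<in>H. {x. x + t \<in> U})"
  proof
    fix x assume x: "x \<in> H"
    then have "x + (- x + x0) \<in> U" "- x + x0 \<in> H"
      using x0 x0H by (auto simp: U_def add.assoc[symmetric])
    then show "x \<in> (\<Union>t\<in>H. {x. x + t \<in> U})" by blast
  qed
  ultimately obtain T where T: "T \<subseteq> H" "finite T" "H \<subseteq> (\<Union>t\<in>T. {x. x + t \<in> U})"
    using compactE_image[OF compact_H, of H "\<lambda>t. {x. x + t \<in> U}"] by metis
  obtain ts where ts: "set ts = T"
    using T(2) finite_list by blast
  have tsi: "index_list ts"
    using T ts H_nonempty by (auto simp: index_list_def)
  define n where "n = real (length ts)"
  have n: "n > 0"
    using tsi by (auto simp: n_def index_list_def)
  have "f x0 / 2 / n \<le> ravg ts f x" if x: "x \<in> H" for x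
  proof -
    obtain t where t: "t \<in> set ts" "x + t \<in> U"
      using T(3) x ts by auto
    \<comment> \<open>The lemma bounds sums from above, so it is applied to \<open>- f\<close> with
      upper bound \<open>0\<close>.\<close>
    have "(\<Sum>s\<leftarrow>ts. - f (x + s)) \<le> real (length ts) * 0 - f x0 / 2"
      by (rule sum_list_le_one_smaller[OF _ t(1)])
        (use tsi x nn t(2) in \<open>auto simp: index_list_def U_def\<close>)
    then have "f x0 / 2 \<le> (\<Sum>s\<leftarrow>ts. f (x + s))"
      using sum_list_const_mult[of "-1" "\<lambda>s. f (x + s)" ts] by simp
    then show ?thesis
      unfolding ravg_def n_def[symmetric] using n by (intro divide_right_mono) auto
  qed
  then have "f x0 / 2 / n \<le> mean (ravg ts f)"
    using mean_bounds(1)[OF ravg_CH[OF tsi f], of "f x0 / 2 / n"] CH_bounded[OF ravg_CH[OF tsi f]]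
    by (metis abs_le_D1)
  moreover have "f x0 / 2 / n > 0"
    using x0 n by simp
  ultimately show ?thesis
    unfolding mean_ravg[OF f tsi] by linarith
qed

end

section \<open>Convolution operators\<close>

text \<open>\<open>c n\<close> will be the norm of the iterate number \<open>n\<close>.
  Log-convexity makes the ratios \<open>c (Suc n) / c n\<close> increase to a limit
  \<open>l\<close>. With \<open>b (Suc n) = c n\<close> the third hypothesis reads
  \<open>b (n + m) \<le> b n * b m\<close> for positive indices, which explains the exponent
  \<open>Suc n\<close>: as in Fekete's lemma, \<open>b n\<close> cannot fall below the
  \<open>n\<close>-th power of its growth rate.\<close>

lemma submultiplicative_logconvex_limit:
  fixes c :: "nat \<Rightarrow> real"
  assumes pos: "\<And>n. c n > 0"
    and logconvex: "\<And>n. (c (Suc n))\<^sup>2 \<le> c n * c (Suc (Suc n))"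
    and submult: "\<And>n m. c (Suc (n + m)) \<le> c n * c m"
  shows "\<exists>l>0. (\<forall>n. l ^ Suc n \<le> c n) \<and> convergent (\<lambda>n. c n / l ^ n)"
proof -
  define r where "r n = c (Suc n) / c n" for n
  have r_pos: "r n > 0" for n
    using pos by (simp add: r_def)
  have "r n \<le> r (Suc n)" for n
    using logconvex[of n] pos[of n] pos[of "Suc n"] by (simp add: r_def field_simps power2_eq_square)
  then have inc: "incseq r"
    by (rule incseq_SucI)
  have "r n \<le> c 0" for n
    using submult[of n 0] pos[of n] by (simp add: r_def field_simps)
  then obtain l where l: "r \<longlonglongrightarrow> l" "\<And>n. r n \<le> l"
    using incseq_convergent[OF inc] by metis
  have l_pos: "l > 0"
    using l(2)[of 0] r_pos[of 0] by linarith
  have step: "c (Suc n) \<le> l * c n" for n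
    using l(2)[of n] pos[of n] by (simp add: r_def field_simps)
  have "decseq (\<lambda>n. c n / l ^ n)"
    using step l_pos by (intro decseq_SucI) (simp add: field_simps)
  moreover have "\<forall>n. 0 \<le> c n / l ^ n"
    using pos l_pos by (simp add: less_imp_le)
  ultimately obtain L where "(\<lambda>n. c n / l ^ n) \<longlonglongrightarrow> L"
    by (rule decseq_convergent)
  then have conv: "convergent (\<lambda>n. c n / l ^ n)"
    by (auto simp: convergent_def)
  have "l ^ Suc n \<le> c n" for n
  proof (rule ccontr)
    assume "\<not> l ^ Suc n \<le> c n"
    then have less: "c n < l ^ Suc n" by simp
    have "(\<lambda>k. r k ^ Suc n) \<longlonglongrightarrow> l ^ Suc n"
      by (intro tendsto_power l(1))
    then have "\<forall>\<^sub>F k in sequentially. c n < r k ^ Suc n"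
      using less by (rule order_tendstoD(1))
    then obtain N where N: "c n < r N ^ Suc n"
      by (auto simp: eventually_sequentially)
    \<comment> \<open>From index \<open>N\<close> on, \<open>c\<close> grows at least at the rate
      \<open>q\<close>. In blocks of \<open>Suc n\<close> indices, submultiplicativity would force a
      slower growth.\<close>
    define q where "q = r N"
    have q: "q > 0" using r_pos by (simp add: q_def)
    have low: "c N * q ^ j \<le> c (N + j)" for j
    proof (induction j)
      case (Suc j)
      have "q \<le> r (N + j)"
        unfolding q_def using inc by (auto simp: incseq_def)
      then have "q * c (N + j) \<le> c (N + Suc j)"
        using pos[of "N + j"] by (simp add: r_def field_simps)
      moreover have "q * (c N * q ^ j) \<le> q * c (N + j)"
        using Suc q by (intro mult_left_mono) auto
      ultimately show ?case by (simp add: mult.left_commute)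
    qed simp
    have up: "c (m * Suc n + n) \<le> c n ^ Suc m" for m
    proof (induction m)
      case (Suc m)
      have "c (Suc m * Suc n + n) = c (Suc ((m * Suc n + n) + n))"
        by (simp add: algebra_simps)
      also have "\<dots> \<le> c (m * Suc n + n) * c n"
        by (rule submult)
      also have "\<dots> \<le> c n ^ Suc m * c n"
        using Suc pos[of n] by (intro mult_right_mono) auto
      finally show ?case by (simp add: mult.commute)
    qed simp
    \<comment> \<open>\<open>\<theta>\<close> compares the two growth rates over one block of
      \<open>Suc n\<close> indices, and \<open>\<delta>\<close> collects the leftover constants. The
      two bounds give \<open>\<delta> \<le> \<theta> ^ m\<close> for all large \<open>m\<close>,
      although \<open>\<theta> < 1\<close>.\<close>
    define \<theta> where "\<theta> = c n / q ^ Suc n"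
    define \<delta> where "\<delta> = c N * q ^ n / (c n * q ^ N)"
    have \<theta>: "0 \<le> \<theta>" "\<theta> < 1"
      using N q pos[of n] by (auto simp: \<theta>_def q_def)
    have \<delta>: "\<delta> > 0"
      using pos q by (simp add: \<delta>_def)
    have "\<delta> \<le> \<theta> ^ m" if "m \<ge> N" for m
    proof -
      have "N \<le> m * Suc n + n"
        using that by simp
      then obtain j where j: "m * Suc n + n = N + j"
        using le_Suc_ex by blast
      have "c N * q ^ (m * Suc n + n) = (c N * q ^ j) * q ^ N"
        unfolding j by (simp add: power_add)
      also have "\<dots> \<le> c n ^ Suc m * q ^ N"
        using low[of j] up[of m] q unfolding j by (intro mult_right_mono) auto
      finally have "c N * q ^ n * (q ^ Suc n) ^ m \<le> c n ^ m * (c n * q ^ N)"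
        unfolding power_add mult.commute[of m] power_mult by (simp add: mult_ac)
      moreover have "0 < (q ^ Suc n) ^ m" "0 < c n * q ^ N"
        using q pos[of n] by auto
      moreover have "A / B \<le> C / D" if "A * D \<le> C * B" "0 < D" "0 < B" for A B C D :: real
        using that by (simp add: field_simps)
      ultimately show ?thesis
        unfolding \<theta>_def \<delta>_def power_divide by blast
    qed
    moreover have "\<forall>\<^sub>F m in sequentially. \<theta> ^ m < \<delta>"
      using LIMSEQ_power_zero[of \<theta>] \<theta> \<delta> by (intro order_tendstoD(2)) auto
    then obtain M where "\<And>m. m \<ge> M \<Longrightarrow> \<theta> ^ m < \<delta>"
      by (auto simp: eventually_sequentially)
    ultimately show False
      by (meson linorder_not_less max.cobounded1 max.cobounded2)
  qed
  with l_pos conv show ?thesis by blast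
qed

context compact_open_group
begin

lemma mean_continuous:
  fixes F :: "'a::topological_space \<Rightarrow> 'g \<Rightarrow> real"
  assumes F: "continuous_on UNIV (\<lambda>(x, y). F x y)" and CH: "\<And>x. F x \<in> CH"
  shows "continuous_on UNIV (\<lambda>x. mean (F x))"
proof -
  have "((\<lambda>x. mean (F x)) \<longlongrightarrow> mean (F x0)) (at x0)" for x0
  proof (rule tendstoI)
    fix e :: real
    assume "e > 0"
    then have "e / 2 > 0" by simp
    from tube_uniform[OF compact_H F this, of x0] obtain U where
      U: "open U" "x0 \<in> U" "\<And>x y. x \<in> U \<Longrightarrow> y \<in> H \<Longrightarrow> \<bar>F x y - F x0 y\<bar> < e / 2"
      by blast
    have "dist (mean (F x)) (mean (F x0)) < e" if "x \<in> U" for x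
      using mean_diff_le[OF CH CH, of x x0 "e / 2"] U(3)[OF that] \<open>e > 0\<close>
      by (force simp: dist_real_def intro: less_imp_le)
    then show "\<forall>\<^sub>F x in at x0. dist (mean (F x)) (mean (F x0)) < e"
      using U(1,2) unfolding eventually_at_topological by blast
  qed
  then show ?thesis
    by (simp add: continuous_on_def)
qed

text \<open>Fubini by finite averages: the mean over \<open>x\<close> is replaced, uniformly in
  \<open>y\<close>, by the average over one finite list, and finite sums commute with the mean over
  \<open>y\<close>.\<close>

lemma mean_swap:
  assumes F: "continuous_on UNIV (\<lambda>(x, y). F x y)"
    and outside: "\<And>x y. x \<notin> H \<or> y \<notin> H \<Longrightarrow> F x y = 0"
  shows "mean (\<lambda>x. mean (F x)) = mean (\<lambda>y. mean (\<lambda>x. F x y))"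
proof -
  have F': "continuous_on UNIV (\<lambda>(y, x). F x y)"
    using continuous_on_compose2[OF F, of UNIV "\<lambda>(y, x). (x, y)"] by (simp add: case_prod_unfold continuous_on_Pair continuous_on_fst continuous_on_snd)
  have c1: "F x \<in> CH" for x
    using continuous_on_compose2[OF F continuous_on_Pair[OF continuous_on_const[of UNIV x] continuous_on_id]] outside
    by (auto simp: CH_def)
  have c2: "(\<lambda>x. F x y) \<in> CH" for y
    using continuous_on_compose2[OF F continuous_on_Pair[OF continuous_on_id continuous_on_const[of UNIV y]]] outside
    by (auto simp: CH_def)
  have z1: "F x = (\<lambda>y. 0)" if "x \<notin> H" for x using outside that by auto
  have z2: "(\<lambda>x. F x y) = (\<lambda>y. 0)" if "y \<notin> H" for y using outside that by auto
  have m1: "(\<lambda>x. mean (F x)) \<in> CH"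
    using mean_continuous[OF F c1] z1 by (auto simp: CH_def)
  have m2: "(\<lambda>y. mean (\<lambda>x. F x y)) \<in> CH"
    using mean_continuous[OF F' c2] z2 by (auto simp: CH_def)
  have "\<bar>mean (\<lambda>x. mean (F x)) - mean (\<lambda>y. mean (\<lambda>x. F x y))\<bar> \<le> e" if e: "e > 0" for e
  proof -
    define d where "d = e / 3"
    have d: "d > 0" using e by (simp add: d_def)
    have "\<forall>y0. \<exists>U. open U \<and> y0 \<in> U \<and> (\<forall>y\<in>U. \<forall>x\<in>H. \<bar>F x y - F x y0\<bar> < d)"
      using tube_uniform[OF compact_H F' d] by blast
    then obtain U where U: "\<And>y0. open (U y0)" "\<And>y0. y0 \<in> U y0"
      "\<And>y0 y x. y \<in> U y0 \<Longrightarrow> x \<in> H \<Longrightarrow> \<bar>F x y - F x y0\<bar> < d"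
      by metis
    \<comment> \<open>Every section in \<open>x\<close> lies within \<open>d\<close> of one of
      finitely many. For those a common list exists, and three errors of size \<open>d\<close> add
      up to \<open>e\<close>.\<close>
    obtain Y where Y: "Y \<subseteq> H" "finite Y" "H \<subseteq> (\<Union>y\<in>Y. U y)"
      using compactE_image[OF compact_H, of H U] U(1,2) by blast
    have "(\<lambda>y x. F x y) ` Y \<subseteq> CH"
      using c2 by auto
    then obtain as where as: "index_list as"
      "\<And>y x. y \<in> Y \<Longrightarrow> x \<in> H \<Longrightarrow> \<bar>ravg as (\<lambda>x. F x y) x - mean (\<lambda>x. F x y)\<bar> \<le> d"
      using ravg_simultaneous[of "(\<lambda>y x. F x y) ` Y" d] Y(2) d by auto
    have near: "\<bar>ravg as (\<lambda>x. F x y) x - mean (\<lambda>x. F x y)\<bar> \<le> e" if y: "y \<in> H" and x: "x \<in> H" for x y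
    proof -
      obtain y0 where y0: "y0 \<in> Y" "y \<in> U y0" using Y(3) y by blast
      have "\<bar>mean (\<lambda>x. F x y) - mean (\<lambda>x. F x y0)\<bar> \<le> d"
        using U(3)[OF y0(2)] by (intro mean_diff_le c2) (auto intro: less_imp_le)
      moreover have "\<bar>ravg as (\<lambda>x. F x y) x - ravg as (\<lambda>x. F x y0) x\<bar> \<le> d"
        using U(3)[OF y0(2)] x as(1) by (intro ravg_diff_le) (auto intro: less_imp_le)
      ultimately show ?thesis
        using as(2)[OF y0(1) x] unfolding d_def by linarith
    qed
    have "\<bar>mean (\<lambda>y. ravg as (\<lambda>x. F x y) x) - mean (\<lambda>y. mean (\<lambda>x. F x y))\<bar> \<le> e" if x: "x \<in> H" for x
      using near x by (intro mean_diff_le m2)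
        (auto simp: ravg_def index_list_def intro!: CH_divide CH_sum_list c1)
    moreover have "mean (\<lambda>y. ravg as (\<lambda>x. F x y) x) = ravg as (\<lambda>x. mean (F x)) x" for x
    proof -
      have "mean (\<lambda>y. \<Sum>a\<leftarrow>as. F (x + a) y) = (\<Sum>a\<leftarrow>as. mean (F (x + a)))"
        by (induction as) (simp_all add: mean_add c1 CH_sum_list)
      then show ?thesis
        using mean_cmult[of "\<lambda>y. \<Sum>a\<leftarrow>as. F (x + a) y" "inverse (length as)"]
        by (simp add: ravg_def divide_inverse mult.commute c1 CH_sum_list)
    qed
    \<comment> \<open>\<open>mean_diff_le\<close> compares members of \<open>CH\<close>, so the
      constant enters as its cutoff to \<open>H\<close>, whose mean is found by
      \<open>mean_bounds\<close>.\<close>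
    ultimately have "\<bar>mean (ravg as (\<lambda>x. mean (F x))) - mean (\<lambda>y. mean (\<lambda>x. F x y))\<bar> \<le> e"
      using mean_diff_le[OF ravg_CH[OF as(1) m1] CH_const, of "mean (\<lambda>y. mean (\<lambda>x. F x y))" e]
        mean_bounds[OF CH_const, of "mean (\<lambda>y. mean (\<lambda>x. F x y))" "mean (\<lambda>y. mean (\<lambda>x. F x y))" "mean (\<lambda>y. mean (\<lambda>x. F x y))"]
      by auto
    then show ?thesis
      by (simp add: mean_ravg[OF m1 as(1)])
  qed
  then show ?thesis
    using field_le_epsilon[of "\<bar>mean (\<lambda>x. mean (F x)) - mean (\<lambda>y. mean (\<lambda>x. F x y))\<bar>" 0] by simp
qed

section \<open>The mean-square inner product\<close>

definition ip :: "('g \<Rightarrow> real) \<Rightarrow> ('g \<Rightarrow> real) \<Rightarrow> real" where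
  "ip f g = mean (\<lambda>x. f x * g x)"

definition nrm :: "('g \<Rightarrow> real) \<Rightarrow> real" where
  "nrm f = sqrt (ip f f)"

lemma ip_commute: "ip f g = ip g f"
  by (simp add: ip_def mult.commute)

lemma ip_diff: "f \<in> CH \<Longrightarrow> g \<in> CH \<Longrightarrow> h \<in> CH \<Longrightarrow> ip f (\<lambda>x. g x - h x) = ip f g - ip f h"
  by (simp add: ip_def right_diff_distrib mean_diff CH_mult)

lemma ip_cmult: "f \<in> CH \<Longrightarrow> g \<in> CH \<Longrightarrow> ip f (\<lambda>x. c * g x) = c * ip f g"
  using mean_cmult[of "\<lambda>x. f x * g x" c] by (simp add: ip_def CH_mult mult.left_commute)

lemma ip_sum: "f \<in> CH \<Longrightarrow> (\<And>i. i \<in> I \<Longrightarrow> g i \<in> CH) \<Longrightarrow> ip f (\<lambda>x. \<Sum>i\<in>I. g i x) = (\<Sum>i\<in>I. ip f (g i))"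
  by (simp add: ip_def sum_distrib_left mean_sum CH_mult)

lemma ip_diff_self:
  "f \<in> CH \<Longrightarrow> g \<in> CH \<Longrightarrow> ip (\<lambda>x. f x - g x) (\<lambda>x. f x - g x) = ip f f - 2 * ip f g + ip g g"
  using ip_diff[of "\<lambda>x. f x - g x" f g] ip_diff[of f f g] ip_diff[of g f g] CH_diff[of f g]
    ip_commute[of "\<lambda>x. f x - g x" f] ip_commute[of "\<lambda>x. f x - g x" g] ip_commute[of f g]
  by simp

lemma ip_nonneg: "f \<in> CH \<Longrightarrow> 0 \<le> ip f f"
  unfolding ip_def by (rule mean_nonneg) (auto intro: CH_mult)

lemma ip_pos: "f \<in> CH \<Longrightarrow> f x \<noteq> 0 \<Longrightarrow> 0 < ip f f"
  unfolding ip_def by (rule mean_pos[of _ x]) (auto intro: CH_mult simp: zero_less_mult_iff)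

lemma ip_eq_0D: "f \<in> CH \<Longrightarrow> ip f f = 0 \<Longrightarrow> f x = 0"
  using ip_pos[of f x] by auto

lemma nrm_nonneg: "f \<in> CH \<Longrightarrow> 0 \<le> nrm f"
  and nrm_square: "f \<in> CH \<Longrightarrow> (nrm f)\<^sup>2 = ip f f"
  by (simp_all add: nrm_def ip_nonneg)

lemma Cauchy_Schwarz:
  assumes f: "f \<in> CH" and g: "g \<in> CH"
  shows "\<bar>ip f g\<bar> \<le> nrm f * nrm g"
proof (cases "ip g g = 0")
  case True
  then have "g = (\<lambda>x. 0)"
    using ip_eq_0D[OF g] by auto
  then show ?thesis
    using f by (simp add: ip_def nrm_def)
next
  case False
  then have pos: "ip g g > 0"
    using ip_nonneg[OF g] by simp
  define t where "t = ip f g / ip g g"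
  have "0 \<le> ip f f - 2 * ip f (\<lambda>x. t * g x) + ip (\<lambda>x. t * g x) (\<lambda>x. t * g x)"
    using ip_nonneg[OF CH_diff[OF f CH_cmult[OF g, of t]]] ip_diff_self[OF f CH_cmult[OF g, of t]] by simp
  also have "\<dots> = ip f f - 2 * (t * ip f g) + t * (t * ip g g)"
    using ip_cmult[OF f g, of t] ip_cmult[OF CH_cmult[OF g] g, of t t] ip_cmult[OF g g, of t]
      ip_commute[of "\<lambda>x. t * g x" g] by simp
  also have "\<dots> = ip f f - (ip f g)\<^sup>2 / ip g g"
    using pos by (simp add: t_def field_simps power2_eq_square)
  finally have "(ip f g)\<^sup>2 \<le> ip f f * ip g g"
    using pos by (simp add: field_simps)
  then have "(ip f g)\<^sup>2 \<le> (nrm f * nrm g)\<^sup>2"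
    using f g by (simp add: power_mult_distrib nrm_square)
  then show ?thesis
    using f g by (intro abs_le_square_iff[THEN iffD2, of "ip f g" "nrm f * nrm g", THEN order_trans])
      (simp_all add: nrm_nonneg)
qed

lemma nrm_le:
  assumes f: "f \<in> CH" and B: "\<And>x. x \<in> H \<Longrightarrow> \<bar>f x\<bar> \<le> B"
  shows "nrm f \<le> B"
proof -
  have "0 \<le> B"
    using B[of 0] zero_H by linarith
  have "f x * f x \<le> B * B" if "x \<in> H" for x
    using mult_mono[OF B[OF that] B[OF that] \<open>0 \<le> B\<close>] by simp
  then have "ip f f \<le> B * B"
    unfolding ip_def by (intro mean_bounds(2)[OF CH_mult[OF f f], of 0]) auto
  then show ?thesis
    unfolding nrm_def using \<open>0 \<le> B\<close> real_sqrt_le_mono[of "ip f f" "B * B"] by simp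
qed

lemma ip_left: "f \<in> CH \<Longrightarrow> g \<in> CH \<Longrightarrow> a \<in> H \<Longrightarrow> ip (\<lambda>x. f (a + x)) (\<lambda>x. g (a + x)) = ip f g"
  unfolding ip_def using mean_left[of "\<lambda>x. f x * g x" a] by (simp add: CH_mult)

lemma ip_left_shift:
  assumes "f \<in> CH" "g \<in> CH" "a \<in> H"
  shows "ip (\<lambda>x. f (a + x)) g = ip f (\<lambda>x. g (- a + x))"
proof -
  have "ip (\<lambda>x. f (a + x)) (\<lambda>x. g (- a + (a + x))) = ip f (\<lambda>x. g (- a + x))"
    using assms by (intro ip_left[of f "\<lambda>x. g (- a + x)"] CH_left) auto
  then show ?thesis
    by (simp add: add.assoc[symmetric])
qed

lemma nrm_left: "f \<in> CH \<Longrightarrow> a \<in> H \<Longrightarrow> nrm (\<lambda>x. f (a + x)) = nrm f"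
  by (simp add: nrm_def ip_left)

section \<open>Convolution with a continuous kernel\<close>

text \<open>An integral operator whose kernel \<open>s (- x + y)\<close> does not change when both
  variables are translated on the left. It therefore commutes with left translations by
  \<open>H\<close> (\<open>conv_left\<close>), which makes its eigenspaces invariant under
  them.\<close>

definition conv :: "('g \<Rightarrow> real) \<Rightarrow> ('g \<Rightarrow> real) \<Rightarrow> 'g \<Rightarrow> real" where
  "conv s f x = mean (\<lambda>y. s (- x + y) * f y)"

lemma conv_integrand: "s \<in> CH \<Longrightarrow> f \<in> CH \<Longrightarrow> (\<lambda>y. s (- x + y) * f y) \<in> CH"
  by (auto simp: CH_def intro!: continuous_intros continuous_on_compose2[of UNIV s])

lemma conv_outside:
  assumes s: "s \<in> CH" and f: "f \<in> CH" and x: "x \<notin> H"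
  shows "s (- x + y) * f y = 0"
proof (cases "y \<in> H")
  case True
  then have "- x + y \<notin> H"
    using x by simp
  then show ?thesis
    using CH_outside[OF s] by simp
qed (simp add: CH_outside[OF f])

lemma conv_CH:
  assumes s: "s \<in> CH" and f: "f \<in> CH"
  shows "conv s f \<in> CH"
proof -
  have "continuous_on UNIV (\<lambda>(x, y). s (- x + y) * f y)"
    unfolding case_prod_unfold by (intro continuous_intros CH_compose[OF s] CH_compose[OF f])
  then have "continuous_on UNIV (conv s f)"
    unfolding conv_def[abs_def] by (rule mean_continuous) (rule conv_integrand[OF assms])
  moreover have "conv s f x = 0" if "x \<notin> H" for x
    unfolding conv_def conv_outside[OF assms that] by simp
  ultimately show ?thesis
    by (simp add: CH_def)
qed

lemma conv_eq_ip: "conv s f x = ip (\<lambda>y. s (- x + y)) f"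
  by (simp add: conv_def ip_def)

lemma conv_left:
  assumes "s \<in> CH" "f \<in> CH" "a \<in> H"
  shows "conv s (\<lambda>y. f (a + y)) x = conv s f (a + x)"
proof -
  have "- (a + x) + (a + y) = - x + y" for y
    by (simp add: minus_add add.assoc[symmetric])
  then show ?thesis
    using mean_left[OF conv_integrand[OF assms(1,2), of "a + x"] assms(3)] by (simp add: conv_def)
qed

lemma conv_diff: "s \<in> CH \<Longrightarrow> f \<in> CH \<Longrightarrow> g \<in> CH \<Longrightarrow> conv s (\<lambda>y. f y - g y) x = conv s f x - conv s g x"
  by (simp add: conv_def right_diff_distrib mean_diff conv_integrand)

lemma conv_cmult: "s \<in> CH \<Longrightarrow> f \<in> CH \<Longrightarrow> conv s (\<lambda>y. c * f y) x = c * conv s f x"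
  using mean_cmult[OF conv_integrand[of s f x], of c] by (simp add: conv_def mult.left_commute)

lemma conv_sum: "s \<in> CH \<Longrightarrow> (\<And>i. i \<in> I \<Longrightarrow> f i \<in> CH) \<Longrightarrow> conv s (\<lambda>y. \<Sum>i\<in>I. f i y) x = (\<Sum>i\<in>I. conv s (f i) x)"
  by (simp add: conv_def sum_distrib_left mean_sum conv_integrand)

text \<open>By \<open>mean_swap\<close> the adjoint has the kernel with its variables exchanged,
  which is the kernel of the reflected function. For even \<open>s\<close> the operator is
  symmetric.\<close>

lemma conv_adjoint:
  assumes s: "s \<in> CH" and f: "f \<in> CH" and g: "g \<in> CH"
  shows "ip (conv s f) g = ip f (conv (\<lambda>x. s (- x)) g)"
proof -
  let ?F = "\<lambda>x y. s (- x + y) * f y * g x"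
  have "ip (conv s f) g = mean (\<lambda>x. mean (?F x))"
    unfolding ip_def conv_def
    using mean_cmult[OF conv_integrand[OF s f]] by (simp add: mult.commute)
  also have "\<dots> = mean (\<lambda>y. mean (\<lambda>x. ?F x y))"
    using CH_outside[OF f] CH_outside[OF g]
    by (intro mean_swap) (auto simp: case_prod_unfold intro!: continuous_intros CH_compose[OF s] CH_compose[OF f] CH_compose[OF g])
  also have "\<dots> = mean (\<lambda>y. f y * mean (\<lambda>x. s (- (- y + x)) * g x))"
    using mean_cmult[OF conv_integrand[OF CH_minus[OF s] g]]
    by (simp add: mult_ac minus_add)
  finally show ?thesis
    by (simp add: ip_def conv_def)
qed

end

section \<open>The Peter-Weyl theorem\<close>

context compact_open_group
begin

lemma conv_lincomb:
  assumes s: "s \<in> CH" and f: "\<And>i. i \<in> I \<Longrightarrow> f i \<in> CH"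
  shows "conv s (\<lambda>y. \<Sum>i\<in>I. c i * f i y) x = (\<Sum>i\<in>I. c i * conv s (f i) x)"
proof -
  have "conv s (\<lambda>y. \<Sum>i\<in>I. c i * f i y) x = (\<Sum>i\<in>I. conv s (\<lambda>y. c i * f i y) x)"
    using f by (intro conv_sum[OF s] CH_cmult)
  then show ?thesis
    using f by (simp add: conv_cmult[OF s])
qed

section \<open>Representative functions and eigenspaces\<close>

definition rep :: "('g \<Rightarrow> real) \<Rightarrow> bool" where
  "rep p \<longleftrightarrow> p \<in> CH \<and> (\<exists>(n::nat) a b. (\<forall>i<n. a i \<in> CH \<and> b i \<in> CH) \<and>
     (\<forall>x\<in>H. \<forall>h\<in>H. p (x + h) = (\<Sum>i<n. a i x * b i h)))"

lemma rep_CH: "rep p \<Longrightarrow> p \<in> CH"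
  by (simp add: rep_def)

lemma rep_left:
  assumes "rep p" "c \<in> H"
  shows "rep (\<lambda>x. p (c + x))"
proof -
  obtain n :: nat and a b where ab: "\<forall>i<n. a i \<in> CH \<and> b i \<in> CH"
    "\<forall>x\<in>H. \<forall>h\<in>H. p (x + h) = (\<Sum>i<n. a i x * b i h)"
    using assms(1) unfolding rep_def by blast
  have "\<forall>i<n. (\<lambda>x. a i (c + x)) \<in> CH \<and> b i \<in> CH"
    using ab(1) assms(2) by (auto intro: CH_left)
  moreover have "\<forall>x\<in>H. \<forall>h\<in>H. p (c + (x + h)) = (\<Sum>i<n. a i (c + x) * b i h)"
    using ab(2) assms(2) by (simp add: add.assoc[symmetric])
  ultimately show ?thesis
    unfolding rep_def using CH_left[OF rep_CH[OF assms(1)] assms(2)]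
    by (intro conjI exI[of _ n] exI[of _ "\<lambda>i x. a i (c + x)"] exI[of _ b]) auto
qed

text \<open>As a function of \<open>y\<close>, \<open>p (x + y)\<close> is a combination of the
  \<open>b i\<close>. Convolution commutes with left translation, so it only acts on these second
  factors.\<close>

lemma rep_conv:
  assumes s: "s \<in> CH" and p: "rep p"
  shows "rep (conv s p)"
proof -
  obtain n :: nat and a b where ab: "\<forall>i<n. a i \<in> CH \<and> b i \<in> CH"
    "\<forall>x\<in>H. \<forall>h\<in>H. p (x + h) = (\<Sum>i<n. a i x * b i h)"
    using p unfolding rep_def by blast
  have "conv s p (x + h) = (\<Sum>i<n. a i x * conv s (b i) h)" if x: "x \<in> H" for x h
  proof -
    \<comment> \<open>The convolution needs the expansion for every \<open>y\<close> in the group;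
      off \<open>H\<close> both sides vanish.\<close>
    have eq: "p (x + y) = (\<Sum>i<n. a i x * b i y)" for y
    proof (cases "y \<in> H")
      case False
      then have "p (x + y) = 0" "\<forall>i<n. b i y = 0"
        using x ab(1) CH_outside rep_CH[OF p] by auto
      then show ?thesis by simp
    qed (use ab(2) x in auto)
    have "conv s p (x + h) = conv s (\<lambda>y. p (x + y)) h"
      using conv_left[OF s rep_CH[OF p] x] by simp
    also have "\<dots> = (\<Sum>i<n. a i x * conv s (b i) h)"
      unfolding eq using ab(1) by (intro conv_lincomb[OF s]) auto
    finally show ?thesis .
  qed
  then show ?thesis
    unfolding rep_def using conv_CH[OF s rep_CH[OF p]] ab(1) conv_CH[OF s]
    by (intro conjI exI[of _ n] exI[of _ a] exI[of _ "\<lambda>i. conv s (b i)"]) auto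
qed

definition rep_perp :: "('g \<Rightarrow> real) set" where
  "rep_perp = {f \<in> CH. \<forall>p. rep p \<longrightarrow> ip f p = 0}"

text \<open>The adjoint is again a convolution operator, and it preserves representative functions
  by \<open>rep_conv\<close>.\<close>

lemma rep_perp_conv:
  assumes s: "s \<in> CH" and f: "f \<in> rep_perp"
  shows "conv s f \<in> rep_perp"
  using assms conv_CH[OF s] conv_adjoint[OF s] rep_conv[OF CH_minus[OF s]] rep_CH
  by (auto simp: rep_perp_def)

definition orthonormal :: "nat \<Rightarrow> (nat \<Rightarrow> 'g \<Rightarrow> real) \<Rightarrow> bool" where
  "orthonormal n e \<longleftrightarrow> (\<forall>i<n. e i \<in> CH) \<and> (\<forall>i<n. \<forall>j<n. ip (e i) (e j) = (if i = j then 1 else 0))"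

lemma orthonormal_ip_sum:
  assumes e: "orthonormal n e" and j: "j < n"
  shows "ip (e j) (\<lambda>x. \<Sum>i<n. c i * e i x) = c j"
proof -
  have eCH: "\<And>i. i < n \<Longrightarrow> e i \<in> CH"
    using e by (simp add: orthonormal_def)
  have "ip (e j) (\<lambda>x. \<Sum>i<n. c i * e i x) = (\<Sum>i<n. c i * ip (e j) (e i))"
    using eCH j by (subst ip_sum) (auto intro!: CH_cmult sum.cong ip_cmult)
  also have "\<dots> = (\<Sum>i<n. if i = j then c i else 0)"
    using e j by (intro sum.cong) (auto simp: orthonormal_def)
  finally show ?thesis
    using j by simp
qed

lemma Bessel:
  assumes e: "orthonormal n e" and w: "w \<in> CH"
  shows "(\<Sum>i<n. (ip w (e i))\<^sup>2) \<le> ip w w"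
proof -
  have eCH: "\<And>i. i < n \<Longrightarrow> e i \<in> CH"
    using e by (simp add: orthonormal_def)
  define u where "u = (\<lambda>x. \<Sum>i<n. ip w (e i) * e i x)"
  have u: "u \<in> CH"
    unfolding u_def using eCH by (intro CH_sum CH_cmult) auto
  have ip_u: "ip v u = (\<Sum>i<n. ip w (e i) * ip v (e i))" if "v \<in> CH" for v
    unfolding u_def using eCH that by (subst ip_sum) (auto intro!: CH_cmult sum.cong ip_cmult)
  have "ip u (e i) = ip w (e i)" if "i < n" for i
    using orthonormal_ip_sum[OF e that, of "\<lambda>i. ip w (e i)"] by (simp add: u_def ip_commute)
  then have "ip w u = (\<Sum>i<n. (ip w (e i))\<^sup>2)" "ip u u = (\<Sum>i<n. (ip w (e i))\<^sup>2)"
    using ip_u[OF w] ip_u[OF u] by (simp_all add: power2_eq_square)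
  then show ?thesis
    using ip_nonneg[OF CH_diff[OF w u]] ip_diff_self[OF w u] by simp
qed

text \<open>The Bessel inequality for the functions \<open>y \<mapsto> (k * k)(- x + y)\<close>, integrated over \<open>x\<close>,
  bounds the dimension of the eigenspace; an eigenfunction then expands in a finite
  orthonormal basis together with all its translates.\<close>

lemma rep_eigenfunction:
  assumes k: "k \<in> CH" and even: "\<And>x. k (- x) = k x" and \<mu>: "\<mu> \<noteq> 0"
    and G: "G \<in> CH" and eig: "\<And>x. conv k (conv k G) x = \<mu> * G x"
  shows "rep G"
proof -
  define E where "E = {f \<in> CH. \<forall>x. conv k (conv k f) x = \<mu> * f x}"
  have E_CH: "f \<in> CH" if "f \<in> E" for f
    using that by (simp add: E_def)
  have adj: "ip (conv k f) g = ip f (conv k g)" if "f \<in> CH" "g \<in> CH" for f g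
    using conv_adjoint[OF k that] even by simp
  \<comment> \<open>\<open>conv k k\<close> gives the kernel of the squared operator.
    \<open>K\<close> is its squared norm, which is the same for all its left translates by
    \<open>H\<close>.\<close>
  define K where "K = ip (conv k k) (conv k k)"
  define ON where "ON n e \<longleftrightarrow> orthonormal n e \<and> (\<forall>i<n. e i \<in> E)" for n e
  have bound: "real n * \<mu>\<^sup>2 \<le> K" if "ON n e" for n e
  proof -
    have e: "orthonormal n e" and eE: "\<And>i. i < n \<Longrightarrow> e i \<in> E" and eCH: "\<And>i. i < n \<Longrightarrow> e i \<in> CH"
      using that E_CH by (auto simp: ON_def)
    have "(\<Sum>i<n. \<mu>\<^sup>2 * (e i x * e i x)) \<le> K" if x: "x \<in> H" for x
    proof -
      let ?w = "\<lambda>y. conv k k (- x + y)"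
      have kx: "(\<lambda>y. k (- x + y)) \<in> CH"
        using CH_left[OF k] x by simp
      have w: "?w \<in> CH"
        using CH_left[OF conv_CH[OF k k]] x by simp
      have w_eq: "?w = conv k (\<lambda>y. k (- x + y))"
        using conv_left[OF k k, of "- x"] x by auto
      have "\<mu> * e i x = ip ?w (e i)" if "i < n" for i
      proof -
        have "\<mu> * e i x = conv k (conv k (e i)) x"
          using eE[OF that] by (simp add: E_def)
        also have "\<dots> = ip (\<lambda>y. k (- x + y)) (conv k (e i))"
          by (rule conv_eq_ip)
        also have "\<dots> = ip ?w (e i)"
          unfolding w_eq by (rule adj[symmetric, OF kx eCH[OF that]])
        finally show ?thesis .
      qed
      then have "(\<Sum>i<n. \<mu>\<^sup>2 * (e i x * e i x)) = (\<Sum>i<n. (ip ?w (e i))\<^sup>2)"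
        by (intro sum.cong) (auto simp: power2_eq_square[symmetric] power_mult_distrib[symmetric])
      also have "\<dots> \<le> ip ?w ?w"
        by (rule Bessel[OF e w])
      also have "\<dots> = K"
        unfolding K_def using ip_left[OF conv_CH[OF k k] conv_CH[OF k k], of "- x"] x by simp
      finally show ?thesis .
    qed
    \<comment> \<open>Integration over \<open>x\<close> turns each \<open>e i x * e i x\<close> into
      \<open>1\<close>, so the left side becomes a multiple of \<open>n\<close>.\<close>
    then have "mean (\<lambda>x. \<Sum>i<n. \<mu>\<^sup>2 * (e i x * e i x)) \<le> K"
      using eCH by (intro mean_bounds(2)[of _ 0] CH_sum CH_cmult CH_mult) (auto intro!: sum_nonneg)
    also have "mean (\<lambda>x. \<Sum>i<n. \<mu>\<^sup>2 * (e i x * e i x)) = (\<Sum>i<n. \<mu>\<^sup>2 * ip (e i) (e i))"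
      unfolding ip_def using eCH
      by (subst mean_sum) (auto intro!: CH_cmult CH_mult sum.cong mean_cmult)
    also have "\<dots> = real n * \<mu>\<^sup>2"
      using e by (simp add: orthonormal_def)
    finally show ?thesis .
  qed
  have "n \<le> nat \<lceil>K / \<mu>\<^sup>2\<rceil>" if "\<exists>e. ON n e" for n
  proof -
    have "real n \<le> K / \<mu>\<^sup>2"
      using bound that \<mu> by (auto simp: field_simps)
    then show ?thesis
      by linarith
  qed
  moreover have "\<exists>e. ON 0 e"
    by (simp add: ON_def orthonormal_def)
  ultimately obtain n where "\<exists>e. ON n e" and max: "\<And>m. \<exists>e. ON m e \<Longrightarrow> m \<le> n"
    using GreatestI_nat[of "\<lambda>n. \<exists>e. ON n e" 0 "nat \<lceil>K / \<mu>\<^sup>2\<rceil>"]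
      Greatest_le_nat[of "\<lambda>n. \<exists>e. ON n e" _ "nat \<lceil>K / \<mu>\<^sup>2\<rceil>"] by blast
  then obtain e where ON: "ON n e" by blast
  then have e: "orthonormal n e" and eE: "\<And>i. i < n \<Longrightarrow> e i \<in> E" and eCH: "\<And>i. i < n \<Longrightarrow> e i \<in> CH"
    using E_CH by (auto simp: ON_def)
  have expand: "f x = (\<Sum>i<n. ip f (e i) * e i x)" if f: "f \<in> E" for f x
  proof -
    define u where "u = (\<lambda>x. \<Sum>i<n. ip f (e i) * e i x)"
    \<comment> \<open>The remainder lies in \<open>E\<close> and is orthogonal to all
      \<open>e i\<close>. Were it nonzero, its normalisation would enlarge the system, against the
      maximality of \<open>n\<close>.\<close>
    define v where "v = (\<lambda>x. f x - u x)"
    have uCH: "u \<in> CH"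
      unfolding u_def using eCH by (intro CH_sum CH_cmult) auto
    have vCH: "v \<in> CH"
      unfolding v_def by (intro CH_diff E_CH f uCH)
    have kk: "conv k (conv k u) x = \<mu> * u x" for x
    proof -
      have "conv k u = (\<lambda>x. \<Sum>i<n. ip f (e i) * conv k (e i) x)"
        unfolding u_def by (intro ext conv_lincomb[OF k]) (simp add: eCH)
      then have "conv k (conv k u) x = (\<Sum>i<n. ip f (e i) * conv k (conv k (e i)) x)"
        using conv_lincomb[OF k, of "{..<n}" "\<lambda>i. conv k (e i)"] conv_CH[OF k eCH] by simp
      also have "\<dots> = \<mu> * u x"
        using eE by (simp add: u_def E_def sum_distrib_left mult_ac)
      finally show ?thesis .
    qed
    have "conv k v = (\<lambda>x. conv k f x - conv k u x)"
      unfolding v_def using conv_diff[OF k E_CH[OF f] uCH] by auto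
    then have kv: "conv k (conv k v) x = \<mu> * v x" for x
      using conv_diff[OF k conv_CH[OF k E_CH[OF f]] conv_CH[OF k uCH]] kk f
      by (simp add: v_def E_def right_diff_distrib)
    have ortho: "ip (e j) v = 0" if "j < n" for j
      unfolding v_def ip_diff[OF eCH[OF that] E_CH[OF f] uCH]
      using orthonormal_ip_sum[OF e that, of "\<lambda>i. ip f (e i)"] by (simp add: u_def ip_commute)
    have "ip v v = 0"
    proof (rule ccontr)
      assume "ip v v \<noteq> 0"
      then have pos: "ip v v > 0"
        using ip_nonneg[OF vCH] by simp
      define z where "z = (\<lambda>x. inverse (nrm v) * v x)"
      define e' where "e' = e(n := z)"
      have nv: "nrm v > 0" "nrm v * nrm v = ip v v"
        using pos by (simp_all add: nrm_def)
      have zCH: "z \<in> CH"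
        unfolding z_def by (rule CH_cmult[OF vCH])
      have "conv k z = (\<lambda>x. inverse (nrm v) * conv k v x)"
        unfolding z_def using conv_cmult[OF k vCH] by auto
      then have zE: "z \<in> E"
        using conv_cmult[OF k conv_CH[OF k vCH]] kv zCH by (simp add: E_def z_def)
      have zv: "ip w z = inverse (nrm v) * ip w v" if "w \<in> CH" for w
        unfolding z_def by (rule ip_cmult[OF that vCH])
      have "ip z z = inverse (nrm v) * (inverse (nrm v) * ip v v)"
        using zv[OF zCH] zv[OF vCH] ip_commute[of z v] by simp
      then have "ip z z = 1"
        using nv(1) unfolding nv(2)[symmetric] by (simp add: field_simps)
      moreover have "ip (e j) z = 0" "ip z (e j) = 0" if "j < n" for j
        using zv[OF eCH[OF that]] ortho[OF that] by (simp_all add: ip_commute[of z])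
      ultimately have "ON (Suc n) e'"
        using e eE zE zCH by (auto simp: ON_def orthonormal_def e'_def less_Suc_eq)
      then have "Suc n \<le> n"
        using max by blast
      then show False by simp
    qed
    then have "v x = 0"
      by (rule ip_eq_0D[OF vCH])
    then show ?thesis
      by (simp add: v_def u_def)
  qed
  have GE: "(\<lambda>y. G (x + y)) \<in> E" if x: "x \<in> H" for x
  proof -
    have "conv k (\<lambda>y. G (x + y)) = (\<lambda>y. conv k G (x + y))"
      using conv_left[OF k G x] by auto
    then show ?thesis
      using conv_left[OF k conv_CH[OF k G] x] eig CH_left[OF G x] by (simp add: E_def)
  qed
  \<comment> \<open>All left translates of \<open>G\<close> by \<open>H\<close> lie in
    \<open>E\<close>. Their coefficients, as functions of the translation, become the first
    factors.\<close>
  define a where "a i x = ip (\<lambda>y. G (x + y)) (e i)" for i x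
  have aCH: "a i \<in> CH" if i: "i < n" for i
  proof -
    have int: "(\<lambda>y. G (x + y) * e i y) \<in> CH" for x
      using CH_outside[OF eCH[OF i]]
      by (auto simp: CH_def intro!: continuous_intros CH_compose[OF G] CH_compose[OF eCH[OF i]])
    have "continuous_on UNIV (\<lambda>(x, y). G (x + y) * e i y)"
      unfolding case_prod_unfold by (intro continuous_intros CH_compose[OF G] CH_compose[OF eCH[OF i]])
    then have "continuous_on UNIV (a i)"
      unfolding a_def ip_def by (rule mean_continuous) (rule int)
    moreover have "a i x = 0" if "x \<notin> H" for x
    proof -
      have "G (x + y) * e i y = 0" for y
        using that CH_outside[OF G, of "x + y"] CH_outside[OF eCH[OF i], of y] by (cases "y \<in> H") auto
      then show ?thesis
        by (simp only: a_def ip_def mean_zero)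
    qed
    ultimately show ?thesis
      by (simp add: CH_def)
  qed
  have "G (x + h) = (\<Sum>i<n. a i x * e i h)" if "x \<in> H" for x h
    using expand[OF GE[OF that], of h] by (simp add: a_def)
  then show ?thesis
    unfolding rep_def using G aCH eCH by (intro conjI exI[of _ n] exI[of _ a] exI[of _ e]) auto
qed

section \<open>Power iteration\<close>

lemma ip_uniform_limit:
  assumes g: "\<And>n. g n \<in> CH" and G: "G \<in> CH" and f: "f \<in> CH" and lim: "uniform_limit UNIV g G sequentially"
  shows "(\<lambda>n. ip f (g n)) \<longlonglongrightarrow> ip f G"
proof (rule tendstoI)
  fix \<epsilon> :: real assume e: "\<epsilon> > 0"
  have "\<epsilon> / (nrm f + 1) > 0"
    using e nrm_nonneg[OF f] by (simp add: add_nonneg_pos)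
  from uniform_limitD[OF lim this]
  show "\<forall>\<^sub>F n in sequentially. dist (ip f (g n)) (ip f G) < \<epsilon>"
  proof (rule eventually_mono)
    fix n assume n: "\<forall>x\<in>UNIV. dist (g n x) (G x) < \<epsilon> / (nrm f + 1)"
    let ?d = "\<lambda>x. g n x - G x"
    have d: "?d \<in> CH" by (rule CH_diff[OF g G])
    have "nrm ?d \<le> \<epsilon> / (nrm f + 1)"
      using n by (intro nrm_le[OF d]) (auto simp: dist_real_def less_imp_le)
    then have "nrm f * nrm ?d \<le> nrm f * (\<epsilon> / (nrm f + 1))"
      using nrm_nonneg[OF f] by (rule mult_left_mono)
    also have "\<dots> < \<epsilon>"
      using e nrm_nonneg[OF f] by (simp add: field_simps)
    finally have "\<bar>ip f ?d\<bar> < \<epsilon>"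
      using Cauchy_Schwarz[OF f d] by linarith
    then show "dist (ip f (g n)) (ip f G) < \<epsilon>"
      using ip_diff[OF f g G, of n] by (simp add: dist_real_def)
  qed
qed

text \<open>Power iteration applied to the kernel itself. The norms of the iterates are
  log-convex because the operator is symmetric and submultiplicative because they are
  kernels of its powers; together this makes the normalised iterates converge to a
  nonzero eigenfunction without any compactness argument.\<close>

lemma eigenfunction_exists:
  assumes k: "k \<in> CH" and even: "\<And>x. k (- x) = k x" and nz: "k x1 \<noteq> 0"
  shows "\<exists>G g \<mu>. G \<in> CH \<and> (\<forall>n::nat. \<exists>j c. g n = (\<lambda>x. c * (conv k ^^ j) k x)) \<and> \<mu> \<noteq> 0 \<and>
    uniform_limit UNIV g G sequentially \<and>
    (\<forall>x. conv k (conv k G) x = \<mu> * G x) \<and> (\<exists>x. G x \<noteq> 0)"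
proof -
  let ?T = "conv k"
  \<comment> \<open>\<open>e n\<close> gives the kernel of the power \<open>Suc n\<close> of
    \<open>?T\<close>, as the proof of \<open>T_bound\<close> shows; this shift of the index
    reappears in \<open>submult\<close>.\<close>
  define e where "e n = (?T ^^ n) k" for n
  have T_CH: "(?T ^^ n) f \<in> CH" if "f \<in> CH" for n f
    using that by (induction n) (auto intro: conv_CH[OF k])
  have e_CH: "e n \<in> CH" for n
    by (simp add: e_def T_CH[OF k])
  have e_Suc: "?T (e n) = e (Suc n)" for n
    by (simp add: e_def)
  have adj1: "ip (?T f) g = ip f (?T g)" if "f \<in> CH" "g \<in> CH" for f g
    using conv_adjoint[OF k that] even by simp
  have adj: "ip ((?T ^^ n) f) g = ip f ((?T ^^ n) g)" if "f \<in> CH" "g \<in> CH" for n f g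
    using that
  proof (induction n arbitrary: g)
    case (Suc n)
    then have "ip ((?T ^^ Suc n) f) g = ip f ((?T ^^ n) (?T g))"
      by (simp add: adj1 T_CH conv_CH[OF k])
    also have "(?T ^^ n) (?T g) = (?T ^^ Suc n) g"
      by (simp add: funpow_swap1)
    finally show ?case .
  qed simp
  have left: "(?T ^^ n) (\<lambda>y. f (a + y)) = (\<lambda>y. (?T ^^ n) f (a + y))" if "f \<in> CH" "a \<in> H" for n f a
    using conv_left[OF k T_CH[OF that(1)] that(2)] by (induction n) auto
  define c where "c n = nrm (e n)" for n
  have T_bound: "\<bar>(?T ^^ Suc n) f x\<bar> \<le> c n * nrm f" if f: "f \<in> CH" for n f x
  proof (cases "x \<in> H")
    case True
    have kx: "(\<lambda>y. k (- x + y)) \<in> CH"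
      using CH_left[OF k] True by simp
    have "(?T ^^ Suc n) f x = ip (\<lambda>y. k (- x + y)) ((?T ^^ n) f)"
      by (simp add: conv_eq_ip)
    also have "\<dots> = ip ((?T ^^ n) (\<lambda>y. k (- x + y))) f"
      by (rule adj[symmetric, OF kx f])
    also have "\<dots> = ip (\<lambda>y. e n (- x + y)) f"
      using left[OF k, of "- x"] True by (simp add: e_def)
    finally show ?thesis
      using Cauchy_Schwarz[OF CH_left[OF e_CH[of n], of "- x"] f] nrm_left[OF e_CH[of n], of "- x"] True
      by (simp add: c_def)
  next
    case False
    have "(?T ^^ Suc n) f x = 0"
      by (rule CH_outside[OF T_CH[OF f] False])
    then show ?thesis
      using nrm_nonneg[OF f] nrm_nonneg[OF e_CH[of n]] by (simp add: c_def)
  qed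
  \<comment> \<open>The inner products of the iterates depend only on \<open>i + j\<close>.
    Log-convexity of the norms is the Cauchy-Schwarz inequality for the iterates \<open>n\<close>
    and \<open>Suc (Suc n)\<close>.\<close>
  define a where "a n = ip k (e n)" for n
  have ip_e: "ip (e i) (e j) = a (i + j)" for i j
    using adj[OF k e_CH, of i j] by (simp add: e_def a_def funpow_add)
  have c_sq: "(c n)\<^sup>2 = a (2 * n)" for n
    by (simp add: c_def nrm_square[OF e_CH] ip_e mult_2)
  have logconvex: "(c (Suc n))\<^sup>2 \<le> c n * c (Suc (Suc n))" for n
    using Cauchy_Schwarz[OF e_CH e_CH, of n "Suc (Suc n)"]
    unfolding c_sq ip_e by (simp add: c_def mult_2)
  have submult: "c (Suc (n + m)) \<le> c n * c m" for n m
  proof -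
    have "e (Suc (n + m)) = (?T ^^ Suc n) (e m)"
      by (simp add: e_def funpow_add)
    then show ?thesis
      unfolding c_def[of "Suc (n + m)"]
      by (intro nrm_le[OF e_CH]) (use T_bound[OF e_CH, of n m] in \<open>simp add: c_def\<close>)
  qed
  have kk: "ip k k > 0"
    by (rule ip_pos[OF k nz])
  have "c n > 0" for n
  proof -
    have "c n > 0 \<and> c (Suc n) > 0"
    proof (induction n)
      case 0
      \<comment> \<open>Log-convexity propagates positivity from two consecutive values. The second
        one is positive because the first iterate takes the value \<open>ip k k\<close> at
        \<open>0\<close>.\<close>
      have "e (Suc 0) 0 = ip k k"
        by (simp add: e_def conv_eq_ip)
      then have "ip (e (Suc 0)) (e (Suc 0)) > 0"
        using kk by (intro ip_pos[OF e_CH, of _ 0]) simp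
      then show ?case
        using kk by (simp add: c_def nrm_def e_def)
    next
      case (Suc n)
      then have "0 < c n * c (Suc (Suc n))"
        using logconvex[of n] by (smt (verit) zero_less_power)
      then show ?case
        using Suc by (simp add: zero_less_mult_iff)
    qed
    then show ?thesis ..
  qed
  from submultiplicative_logconvex_limit[of c, OF this logconvex submult]
  obtain l where l: "l > 0" "\<And>n. l ^ Suc n \<le> c n" "convergent (\<lambda>n. c n / l ^ n)"
    by blast
  \<comment> \<open>Normalised moments of even order. They converge and, by \<open>S_ge\<close>,
    stay away from \<open>0\<close>, so the normalised iterates neither blow up nor die out.\<close>
  define S where "S n = a (2 * n) / l ^ (2 * n)" for n
  have S_eq: "S n = (c n / l ^ n)\<^sup>2" for n
    unfolding S_def power_divide c_sq power_mult[symmetric] by (simp add: mult.commute)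
  have "l \<le> c n / l ^ n" for n
    using l(1) l(2)[of n] by (simp add: field_simps)
  then have S_ge: "l\<^sup>2 \<le> S n" for n
    unfolding S_eq using l(1) by (intro power_mono) auto
  obtain L0 where "(\<lambda>n. c n / l ^ n) \<longlonglongrightarrow> L0"
    using l(3) by (auto simp: convergent_def)
  then have S_lim: "S \<longlonglongrightarrow> L0\<^sup>2"
    unfolding S_eq[abs_def] by (rule tendsto_power)
  \<comment> \<open>The differences of the \<open>w n\<close> are controlled in the mean-square
    norm. One application of \<open>?T\<close> yields \<open>g\<close>, where the control is
    uniform.\<close>
  define w where "w n = (\<lambda>x. inverse (l ^ (2 * n)) * e (2 * n) x)" for n
  define g where "g n = (\<lambda>x. inverse (l ^ (2 * n)) * e (Suc (2 * n)) x)" for n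
  have w_CH: "w n \<in> CH" and g_CH: "g n \<in> CH" for n
    by (auto simp: w_def g_def intro: CH_cmult e_CH)
  have Tw: "?T (w n) = g n" for n
    unfolding w_def g_def using conv_cmult[OF k e_CH] by (auto simp: e_Suc)
  have TTg: "?T (?T (g n)) = (\<lambda>x. l\<^sup>2 * g (Suc n) x)" for n
  proof -
    have "?T (g n) = (\<lambda>x. inverse (l ^ (2 * n)) * e (Suc (Suc (2 * n))) x)"
      unfolding g_def using conv_cmult[OF k e_CH] by (auto simp: e_Suc)
    then have "?T (?T (g n)) = (\<lambda>x. inverse (l ^ (2 * n)) * e (Suc (Suc (Suc (2 * n)))) x)"
      using conv_cmult[OF k e_CH] by (auto simp: e_Suc)
    moreover have "inverse (l ^ (2 * n)) = l\<^sup>2 * inverse (l ^ (2 * Suc n))"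
      using l(1) by (simp add: power2_eq_square field_simps)
    ultimately show ?thesis
      by (simp only: g_def mult.assoc mult_Suc_right add_2_eq_Suc)
  qed
  have ip_scaled: "ip (\<lambda>x. s * e i x) (\<lambda>x. t * e j x) = s * t * a (i + j)" for s t i j
    using ip_cmult[OF CH_cmult[OF e_CH] e_CH, of s i t j] ip_cmult[OF e_CH e_CH, of j s i]
    by (simp add: ip_commute[of _ "e j"] ip_e add.commute)
  have ip_w: "ip (w n) (w m) = S (n + m)" for n m
    unfolding w_def ip_scaled S_def by (simp add: distrib_left power_add divide_inverse mult_ac)
  have ip_g: "ip (g n) (g m) = l\<^sup>2 * S (Suc (n + m))" for n m
    unfolding g_def ip_scaled S_def using l(1)
    by (simp add: field_simps power_add power2_eq_square)
  have "uniformly_Cauchy_on UNIV g"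
  proof (rule uniformly_Cauchy_onI')
    fix \<epsilon> :: real assume e: "\<epsilon> > 0"
    have c0: "c 0 + 1 > 0"
      using nrm_nonneg[OF e_CH[of 0]] by (simp add: c_def add_nonneg_pos)
    \<comment> \<open>The squared norm of \<open>w m - w n\<close> combines three values of
      \<open>S\<close> with weights \<open>1\<close>, \<open>-2\<close>, \<open>1\<close>, so it is
      at most \<open>4 * \<delta>\<close>. The summand in \<open>c 0 + 1\<close> makes the final
      estimate strict.\<close>
    define \<delta> where "\<delta> = (\<epsilon> / (c 0 + 1))\<^sup>2 / 4"
    have d: "\<delta> > 0"
      using e c0 by (simp add: \<delta>_def)
    from LIMSEQ_D[OF S_lim d]
    obtain N where N: "\<And>n. n \<ge> N \<Longrightarrow> \<bar>S n - L0\<^sup>2\<bar> < \<delta>"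
      by (auto simp: real_norm_def)
    have "dist (g m x) (g n x) < \<epsilon>" if "m \<ge> N" "n > m" for m n x
    proof -
      let ?d = "\<lambda>x. w m x - w n x"
      have dCH: "?d \<in> CH" by (rule CH_diff[OF w_CH w_CH])
      have "ip ?d ?d = S (m + m) - 2 * S (m + n) + S (n + n)"
        unfolding ip_diff_self[OF w_CH w_CH] ip_w ..
      also have "\<dots> \<le> 4 * \<delta>"
        using N[of "m + m"] N[of "m + n"] N[of "n + n"] that by auto
      finally have "nrm ?d \<le> \<epsilon> / (c 0 + 1)"
        unfolding nrm_def \<delta>_def using e c0 by (intro real_le_lsqrt) auto
      have "\<bar>?T ?d x\<bar> \<le> c 0 * nrm ?d"
        using T_bound[OF dCH, of 0 x] by simp
      also have "\<dots> \<le> c 0 * (\<epsilon> / (c 0 + 1))"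
        using nrm_nonneg[OF e_CH[of 0]] \<open>nrm ?d \<le> _\<close> by (intro mult_left_mono) (auto simp: c_def)
      also have "\<dots> < \<epsilon>"
        using e c0 by (simp add: field_simps)
      finally show ?thesis
        using conv_diff[OF k w_CH w_CH, of m n x] by (simp add: Tw dist_real_def)
    qed
    then show "\<exists>M. \<forall>x\<in>UNIV. \<forall>m\<ge>M. \<forall>n>m. dist (g m x) (g n x) < \<epsilon>"
      by blast
  qed
  then obtain G where lim: "uniform_limit UNIV g G sequentially"
    using Cauchy_uniformly_convergent uniformly_convergent_on_def by blast
  have pw: "(\<lambda>n. g n x) \<longlonglongrightarrow> G x" for x
    by (rule tendsto_uniform_limitI[OF lim]) simp
  have "continuous_on UNIV G"
    by (rule uniform_limit_theorem[OF _ lim]) (simp_all add: CH_continuous[OF g_CH])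
  moreover have "G x = 0" if "x \<notin> H" for x
    using pw[of x] CH_outside[OF g_CH that] by (simp add: LIMSEQ_const_iff)
  ultimately have G: "G \<in> CH"
    by (simp add: CH_def)
  have eig: "?T (?T G) x = l\<^sup>2 * G x" for x
  proof (cases "x \<in> H")
    case True
    have kx: "(\<lambda>y. k (- x + y)) \<in> CH"
      using CH_left[OF k] True by simp
    \<comment> \<open>By symmetry the value at \<open>x\<close> is an inner product of
      \<open>f\<close> with a fixed function, so it passes to uniform limits.\<close>
    have TT: "?T (?T f) x = ip (?T (\<lambda>y. k (- x + y))) f" if "f \<in> CH" for f
      using adj1[OF kx conv_CH[OF k that]] adj1[OF kx that] by (simp add: conv_eq_ip[of k "conv k f"])
    have "(\<lambda>n. ?T (?T (g n)) x) \<longlonglongrightarrow> ?T (?T G) x"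
      unfolding TT[OF g_CH] TT[OF G] by (rule ip_uniform_limit[OF g_CH G conv_CH[OF k kx] lim])
    moreover have "(\<lambda>n. ?T (?T (g n)) x) \<longlonglongrightarrow> l\<^sup>2 * G x"
      unfolding TTg by (intro tendsto_intros LIMSEQ_Suc pw)
    ultimately show ?thesis
      by (rule LIMSEQ_unique)
  next
    case False
    then show ?thesis
      using CH_outside[OF G] CH_outside[OF conv_CH[OF k conv_CH[OF k G]]] by simp
  qed
  have "\<exists>x. G x \<noteq> 0"
  proof (rule ccontr)
    assume "\<nexists>x. G x \<noteq> 0"
    then have "ip (g 0) G = 0"
      by (simp add: ip_def)
    moreover have "(\<lambda>n. ip (g 0) (g n)) \<longlonglongrightarrow> ip (g 0) G"
      by (rule ip_uniform_limit[OF g_CH G g_CH lim])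
    moreover have "l\<^sup>2 * l\<^sup>2 \<le> ip (g 0) (g n)" for n
      unfolding ip_g using S_ge by (intro mult_left_mono) auto
    ultimately have "l\<^sup>2 * l\<^sup>2 \<le> 0"
      using LIMSEQ_le_const by metis
    then show False
      using l(1) by (simp add: mult_le_0_iff)
  qed
  moreover have "\<exists>j c. g n = (\<lambda>x. c * (conv k ^^ j) k x)" for n
    unfolding g_def e_def by blast
  ultimately show ?thesis
    using G lim eig l(1) by (intro exI[of _ G] exI[of _ g] exI[of _ "l\<^sup>2"]) auto
qed

section \<open>Separation of the points of H by representative functions\<close>

text \<open>Power iteration needs an even kernel, which \<open>f\<close> need not be.
  \<open>conv f f\<close> is even, still lies in \<open>rep_perp\<close>, and is nonzero because its
  value at \<open>0\<close> is \<open>ip f f\<close>.\<close>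

lemma rep_perp_trivial:
  assumes f: "f \<in> rep_perp"
  shows "f x = 0"
proof (rule ccontr)
  assume nz: "f x \<noteq> 0"
  have fCH: "f \<in> CH" using f by (simp add: rep_perp_def)
  define k where "k = conv f f"
  have k: "k \<in> CH" and kp: "k \<in> rep_perp"
    unfolding k_def using conv_CH[OF fCH fCH] rep_perp_conv[OF fCH f] by auto
  have "k (- x) = k x" if "x \<in> H" for x
  proof -
    have "k (- x) = ip (\<lambda>y. f (x + y)) f"
      by (simp add: k_def conv_eq_ip)
    also have "\<dots> = ip f (\<lambda>y. f (- x + y))"
      by (rule ip_left_shift[OF fCH fCH that])
    also have "\<dots> = k x"
      by (simp add: k_def conv_eq_ip ip_commute)
    finally show ?thesis .
  qed
  then have even: "k (- x) = k x" for x
    using CH_outside[OF k] by (cases "x \<in> H") auto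
  have "k 0 = ip f f"
    by (simp add: k_def conv_eq_ip)
  then have k0: "k 0 \<noteq> 0"
    using ip_pos[OF fCH nz] by simp
  from eigenfunction_exists[of k 0, OF k even k0]
  obtain G g \<mu> where G: "G \<in> CH" "\<And>n::nat. \<exists>j c. g n = (\<lambda>x. c * (conv k ^^ j) k x)" "\<mu> \<noteq> 0"
    "uniform_limit UNIV g G sequentially" "\<And>x. conv k (conv k G) x = \<mu> * G x" "\<exists>x. G x \<noteq> 0"
    by blast
  have iter: "(conv k ^^ j) k \<in> rep_perp" for j
    using kp by (induction j) (auto intro: rep_perp_conv[OF k])
  have rG: "rep G"
    by (rule rep_eigenfunction[OF k even G(3) G(1) G(5)])
  have gp: "g n \<in> CH \<and> ip G (g n) = 0" for n
  proof -
    obtain j c where g: "g n = (\<lambda>x. c * (conv k ^^ j) k x)"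
      using G(2) by blast
    have it: "(conv k ^^ j) k \<in> CH" "ip ((conv k ^^ j) k) G = 0"
      using iter[of j] rG by (auto simp: rep_perp_def)
    then show ?thesis
      unfolding g using ip_cmult[OF G(1) it(1)] by (simp add: CH_cmult ip_commute)
  qed
  have "(\<lambda>n. ip G (g n)) \<longlonglongrightarrow> ip G G"
    using gp by (intro ip_uniform_limit G) auto
  then have "ip G G = 0"
    using gp by (simp add: LIMSEQ_const_iff)
  then show False
    using G(6) ip_eq_0D[OF G(1)] by blast
qed

text \<open>A compact Hausdorff space is normal, hence completely regular; the separating function
  on \<open>H\<close> is then extended by zero.\<close>

lemma CH_separates:
  assumes h: "h \<in> H" "h \<noteq> 0"
  shows "\<exists>u\<in>CH. u h \<noteq> u 0"
proof -
  let ?X = "top_of_set H"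
  have "Hausdorff_space (euclidean :: 'g topology)"
    unfolding Hausdorff_space_def disjnt_def using hausdorff by simp blast
  then have "compact_space ?X" "Hausdorff_space ?X"
    using compact_H by (auto simp: compact_space_subtopology Hausdorff_space_subtopology)
  then have cr: "completely_regular_space ?X"
    by (simp add: compact_Hausdorff_or_regular_imp_normal_space normal_imp_completely_regular_space)
  have "closedin ?X {h} \<and> 0 \<in> topspace ?X - {h}"
    using h by (auto simp: closedin_closed intro!: exI[of _ "{h}"])
  from cr[unfolded completely_regular_space_def, rule_format, OF this]
  obtain f :: "'g \<Rightarrow> real" where f: "continuous_map ?X (top_of_set {0..1}) f" "f 0 = 0" "f h = 1"
    by auto
  then have "continuous_on H f"
    by (simp add: continuous_map_in_subtopology)
  then have "(\<lambda>x. if x \<in> H then f x else 0) \<in> CH"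
    by (auto simp: CH_def intro: continuous_cutoff)
  then show ?thesis
    using f h by (intro bexI[of _ "\<lambda>x. if x \<in> H then f x else 0"]) auto
qed

text \<open>If no representative function separates \<open>h\<close> from \<open>0\<close>, all of them are invariant under
  right translation by \<open>h\<close>, so every difference \<open>u (x + h) - u x\<close> is orthogonal to them.\<close>

lemma rep_separates:
  assumes h: "h \<in> H" "h \<noteq> 0"
  shows "\<exists>p. rep p \<and> p h \<noteq> p 0"
proof (rule ccontr)
  assume contra: "\<nexists>p. rep p \<and> p h \<noteq> p 0"
  have inv: "p (x + h) = p x" if p: "rep p" for p x
  proof (cases "x \<in> H")
    case True
    then show ?thesis
      using contra rep_left[OF p True] by (metis add.right_neutral)
  next
    case False
    then show ?thesis
      using h CH_outside[OF rep_CH[OF p]] by simp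
  qed
  obtain u where u: "u \<in> CH" "u h \<noteq> u 0"
    using CH_separates[OF h] by blast
  have uh: "(\<lambda>x. u (x + h)) \<in> CH"
    by (rule CH_right[OF u(1) h(1)])
  have "ip (\<lambda>x. u (x + h) - u x) p = 0" if p: "rep p" for p
  proof -
    have pCH: "p \<in> CH" by (rule rep_CH[OF p])
    have "ip p (\<lambda>x. u (x + h)) = mean (\<lambda>x. p (x + h) * u (x + h))"
      by (simp add: ip_def inv[OF p])
    \<comment> \<open>Right translation by \<open>h\<close> is the average over the list
      \<open>[h]\<close>, so \<open>mean_ravg\<close> applies.\<close>
    also have "\<dots> = mean (ravg [h] (\<lambda>x. p x * u x))"
      by (simp add: ravg_def[abs_def])
    also have "\<dots> = ip p u"
      unfolding ip_def by (rule mean_ravg[OF CH_mult[OF pCH u(1)]]) (simp add: index_list_def h)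
    finally show ?thesis
      using ip_diff[OF pCH uh u(1)] by (simp add: ip_commute)
  qed
  then have "(\<lambda>x. u (x + h) - u x) \<in> rep_perp"
    using CH_diff[OF uh u(1)] by (simp add: rep_perp_def)
  from rep_perp_trivial[OF this, of 0] u(2) show False
    by simp
qed

end

section \<open>The algebra of the group\<close>

definition fun_subspace :: "('a \<Rightarrow> complex) set \<Rightarrow> bool" where
  "fun_subspace V \<longleftrightarrow> (\<lambda>x. 0) \<in> V \<and> (\<forall>f\<in>V. \<forall>g\<in>V. (\<lambda>x. f x + g x) \<in> V) \<and>
     (\<forall>c. \<forall>f\<in>V. (\<lambda>x. c * f x) \<in> V)"

lemma fun_subspace_zero: "fun_subspace V \<Longrightarrow> (\<lambda>x. 0) \<in> V"
  and fun_subspace_add: "fun_subspace V \<Longrightarrow> f \<in> V \<Longrightarrow> g \<in> V \<Longrightarrow> (\<lambda>x. f x + g x) \<in> V"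
  and fun_subspace_cmult: "fun_subspace V \<Longrightarrow> f \<in> V \<Longrightarrow> (\<lambda>x. c * f x) \<in> V"
  by (auto simp: fun_subspace_def)

lemma fun_subspace_diff: "fun_subspace V \<Longrightarrow> f \<in> V \<Longrightarrow> g \<in> V \<Longrightarrow> (\<lambda>x. f x - g x) \<in> V"
  using fun_subspace_add[of V f "\<lambda>x. (-1) * g x"] fun_subspace_cmult[of V g "-1"] by simp

lemma fun_subspace_sum:
  assumes "fun_subspace V" "\<And>i. i \<in> I \<Longrightarrow> f i \<in> V"
  shows "(\<lambda>x. \<Sum>i\<in>I. f i x) \<in> V"
  using assms(2)
  by (induction I rule: infinite_finite_induct)
    (simp_all add: fun_subspace_zero[OF assms(1)] fun_subspace_add[OF assms(1)])

text \<open>Joins two families indexed by initial segments, as closure of \<open>alg_tensor\<close>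
  and \<open>cspan_fun\<close> under addition requires.\<close>

lemma sum_lessThan_append:
  fixes u v :: "nat \<Rightarrow> 'a::comm_monoid_add"
  shows "(\<Sum>i<n + m. if i < n then u i else v (i - n)) = (\<Sum>i<n. u i) + (\<Sum>i<m. v i)"
  by (induction m) (simp_all add: add.assoc)

text \<open>Gaussian elimination on the second factor: the sections of \<open>F\<close> at suitable points
  can be used as the first factor, without enlarging the span of the second ones.\<close>

lemma separated_sections:
  fixes F :: "'a \<Rightarrow> 'b \<Rightarrow> complex" and n :: nat
  assumes V: "fun_subspace V" and W: "fun_subspace W"
    and "\<And>x y. y \<in> Y \<Longrightarrow> F x y = (\<Sum>i<n. a i x * b i y)"
    and "\<And>y. y \<in> Y \<Longrightarrow> (\<lambda>x. F x y) \<in> V" and "\<And>i. i < n \<Longrightarrow> b i \<in> W"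
  shows "\<exists>(m::nat) p q. (\<forall>i<m. p i \<in> V \<and> q i \<in> W) \<and> (\<forall>x. \<forall>y\<in>Y. F x y = (\<Sum>i<m. p i x * q i y))"
  using assms(3-5)
proof (induction n arbitrary: F b)
  case 0
  then show ?case
    by (intro exI[of _ 0]) auto
next
  case (Suc n)
  show ?case
  proof (cases "\<forall>y\<in>Y. b n y = 0")
    case True
    then show ?thesis
      using Suc.prems by (intro Suc.IH[of F b]) auto
  next
    case False
    then obtain y0 where y0: "y0 \<in> Y" "b n y0 \<noteq> 0" by blast
    \<comment> \<open>Normalised to \<open>1\<close> at \<open>y0\<close>, so that subtracting
      \<open>\<beta> y * F x y0\<close> removes the term with index \<open>n\<close>. The section at
      \<open>y0\<close> lies in \<open>V\<close> and becomes a new first factor.\<close>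
    define \<beta> where "\<beta> y = inverse (b n y0) * b n y" for y
    have \<beta>W: "\<beta> \<in> W"
      unfolding \<beta>_def[abs_def] using Suc.prems(3) by (intro fun_subspace_cmult[OF W]) auto
    define F1 where "F1 x y = F x y - \<beta> y * F x y0" for x y
    define b1 where "b1 i y = b i y - b i y0 * \<beta> y" for i y
    have "F1 x y = (\<Sum>i<n. a i x * b1 i y)" if "y \<in> Y" for x y
    proof -
      have "F1 x y = (\<Sum>i<Suc n. a i x * b i y) - \<beta> y * (\<Sum>i<Suc n. a i x * b i y0)"
        using Suc.prems(1)[OF that] Suc.prems(1)[OF y0(1)] by (simp add: F1_def)
      also have "\<dots> = (\<Sum>i<Suc n. a i x * b1 i y)"
        by (simp only: b1_def sum_distrib_left sum_subtractf[symmetric])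
          (intro sum.cong refl, simp add: algebra_simps)
      also have "b1 n y = 0"
        using y0 by (simp add: b1_def \<beta>_def)
      then have "(\<Sum>i<Suc n. a i x * b1 i y) = (\<Sum>i<n. a i x * b1 i y)"
        by simp
      finally show ?thesis .
    qed
    moreover have "(\<lambda>x. F1 x y) \<in> V" if "y \<in> Y" for y
      unfolding F1_def using Suc.prems(2) that y0(1)
      by (intro fun_subspace_diff[OF V] fun_subspace_cmult[OF V])
    moreover have "b1 i \<in> W" if "i < n" for i
      unfolding b1_def[abs_def] using Suc.prems(3) that
      by (intro fun_subspace_diff[OF W] fun_subspace_cmult[OF W] \<beta>W) auto
    ultimately obtain m :: nat and p q where pq: "\<forall>i<m. p i \<in> V \<and> q i \<in> W"
      "\<forall>x. \<forall>y\<in>Y. F1 x y = (\<Sum>i<m. p i x * q i y)"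
      using Suc.IH[of F1 b1] by auto
    let ?p = "p(m := \<lambda>x. F x y0)" and ?q = "q(m := \<beta>)"
    have "\<forall>i<Suc m. ?p i \<in> V \<and> ?q i \<in> W"
      using pq(1) Suc.prems(2)[OF y0(1)] \<beta>W by (auto simp: less_Suc_eq)
    moreover have "F x y = (\<Sum>i<Suc m. ?p i x * ?q i y)" if "y \<in> Y" for x y
    proof -
      have "F x y = F1 x y + F x y0 * \<beta> y"
        by (simp add: F1_def)
      then show ?thesis
        using pq(2) that by (simp add: lessThan_Suc)
    qed
    ultimately show ?thesis
      by (intro exI[of _ "Suc m"] exI[of _ ?p] exI[of _ ?q]) auto
  qed
qed

section \<open>Continuous functions with compact support\<close>

text \<open>Any compact set that contains the nonzero set can replace its closure, so no closure has
  to be computed for sums, products or translates.\<close>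

lemma Cc_iff:
  fixes f :: "'a::t2_space \<Rightarrow> complex"
  shows "f \<in> Cc \<longleftrightarrow> continuous_on UNIV f \<and> (\<exists>K. compact K \<and> (\<forall>x. f x \<noteq> 0 \<longrightarrow> x \<in> K))"
proof
  assume "f \<in> Cc"
  then show "continuous_on UNIV f \<and> (\<exists>K. compact K \<and> (\<forall>x. f x \<noteq> 0 \<longrightarrow> x \<in> K))"
    unfolding Cc_def using closure_subset[of "{x. f x \<noteq> 0}"] by blast
next
  assume "continuous_on UNIV f \<and> (\<exists>K. compact K \<and> (\<forall>x. f x \<noteq> 0 \<longrightarrow> x \<in> K))"
  then obtain K where K: "continuous_on UNIV f" "compact K" "{x. f x \<noteq> 0} \<subseteq> K"
    by auto
  then have "closure {x. f x \<noteq> 0} \<subseteq> K"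
    by (intro closure_minimal compact_imp_closed)
  then have "closure {x. f x \<noteq> 0} = K \<inter> closure {x. f x \<noteq> 0}"
    by blast
  then have "compact (closure {x. f x \<noteq> 0})"
    using K(2) by (metis closed_closure compact_Int_closed)
  with K(1) show "f \<in> Cc"
    by (simp add: Cc_def)
qed

lemma Cc_I:
  fixes f :: "'a::t2_space \<Rightarrow> complex"
  shows "continuous_on UNIV f \<Longrightarrow> compact K \<Longrightarrow> (\<And>x. f x \<noteq> 0 \<Longrightarrow> x \<in> K) \<Longrightarrow> f \<in> Cc"
  by (auto simp: Cc_iff)

lemma Cc_continuous: "f \<in> Cc \<Longrightarrow> continuous_on UNIV f"
  by (simp add: Cc_def)

lemma Cc_subset_C0: "(Cc :: ('a::t2_space \<Rightarrow> complex) set) \<subseteq> C0"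
proof
  fix f :: "'a \<Rightarrow> complex" assume f: "f \<in> Cc"
  then obtain K where K: "compact K" "\<And>x. f x \<noteq> 0 \<Longrightarrow> x \<in> K"
    by (auto simp: Cc_iff)
  have "compact {x. e \<le> norm (f x)}" if "e > 0" for e
  proof -
    have "closed {x. e \<le> norm (f x)}"
      by (intro closed_Collect_le continuous_intros Cc_continuous[OF f])
    moreover have "{x. e \<le> norm (f x)} = K \<inter> {x. e \<le> norm (f x)}"
      using K(2) that by force
    ultimately show ?thesis
      using compact_Int_closed[OF K(1)] by metis
  qed
  then show "f \<in> C0"
    using Cc_continuous[OF f] by (simp add: C0_def)
qed

lemma Cc_mult:
  fixes f g :: "'a::t2_space \<Rightarrow> complex"
  assumes f: "continuous_on UNIV f" and g: "g \<in> Cc"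
  shows "(\<lambda>x. f x * g x) \<in> Cc"
proof -
  obtain K where K: "compact K" "\<And>x. g x \<noteq> 0 \<Longrightarrow> x \<in> K"
    using g unfolding Cc_iff by blast
  show ?thesis
    by (rule Cc_I[OF continuous_on_mult[OF f Cc_continuous[OF g]] K(1)]) (simp add: K(2))
qed

lemma fun_subspace_Cc: "fun_subspace (Cc :: ('a::t2_space \<Rightarrow> complex) set)"
  unfolding fun_subspace_def
proof (intro conjI ballI allI)
  show "(\<lambda>x::'a. 0) \<in> Cc"
    by (rule Cc_I[of _ "{}"]) auto
next
  fix f g :: "'a \<Rightarrow> complex"
  assume fg: "f \<in> Cc" "g \<in> Cc"
  then obtain K L where K: "compact K" "\<And>x. f x \<noteq> 0 \<Longrightarrow> x \<in> K" and L: "compact L" "\<And>x. g x \<noteq> 0 \<Longrightarrow> x \<in> L"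
    unfolding Cc_iff by blast
  have "x \<in> K \<union> L" if "f x + g x \<noteq> 0" for x
    using that K(2)[of x] L(2)[of x] by (cases "f x = 0") auto
  then show "(\<lambda>x. f x + g x) \<in> Cc"
    by (rule Cc_I[OF continuous_on_add[OF Cc_continuous[OF fg(1)] Cc_continuous[OF fg(2)]]
          compact_Un[OF K(1) L(1)]])
next
  fix c and f :: "'a \<Rightarrow> complex"
  assume "f \<in> Cc"
  then show "(\<lambda>x. c * f x) \<in> Cc"
    by (rule Cc_mult[OF continuous_on_const])
qed

lemma Cc_cnj:
  fixes f :: "'a::t2_space \<Rightarrow> complex"
  assumes "f \<in> Cc"
  shows "(\<lambda>x. cnj (f x)) \<in> Cc"
  using assms unfolding Cc_iff by (auto intro!: continuous_intros)

lemma Cc_compose: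
  fixes f :: "'a::t2_space \<Rightarrow> complex" and g :: "'b::t2_space \<Rightarrow> 'a"
  assumes f: "f \<in> Cc" and g: "continuous_on UNIV g" and h: "continuous_on UNIV h" and inv: "\<And>x. h (g x) = x"
  shows "(\<lambda>x. f (g x)) \<in> Cc"
proof -
  obtain K where K: "compact K" "\<And>x. f x \<noteq> 0 \<Longrightarrow> x \<in> K"
    using f unfolding Cc_iff by blast
  have "compact (h ` K)"
    by (rule compact_continuous_image[OF continuous_on_subset[OF h] K(1)]) simp
  moreover have "x \<in> h ` K" if "f (g x) \<noteq> 0" for x
    using K(2)[OF that] inv[of x] by (metis imageI)
  moreover have "continuous_on UNIV (\<lambda>x. f (g x))"
    by (rule continuous_on_compose2[OF Cc_continuous[OF f] g]) simp
  ultimately show ?thesis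
    by (intro Cc_I[of _ "h ` K"])
qed

lemma Cc_left: "f \<in> Cc \<Longrightarrow> (\<lambda>x. f (a + x)) \<in> Cc"
  and Cc_right: "f \<in> Cc \<Longrightarrow> (\<lambda>x. f (x + a)) \<in> Cc"
  and Cc_minus: "f \<in> Cc \<Longrightarrow> (\<lambda>x. f (- x)) \<in> Cc"
  for f :: "'g::{topological_group_add, t2_space} \<Rightarrow> complex"
  by (auto intro!: continuous_intros Cc_compose[of f "\<lambda>x. a + x" "\<lambda>x. - a + x"]
      Cc_compose[of f "\<lambda>x. x + a" "\<lambda>x. x + - a"] Cc_compose[of f uminus uminus]
      simp: add.assoc[symmetric])

section \<open>Closure properties of P(G)\<close>

text \<open>Arbitrary finite index sets let sums and products be indexed by the disjoint union and
  by the pairs of two given families.\<close>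

lemma PG_I:
  assumes "f \<in> Cc" "compact_open_subgroup H" "finite I"
    and fp: "\<And>i. i \<in> I \<Longrightarrow> fs i \<in> Cc \<and> continuous_on H (\<phi> i)"
    and eq: "\<And>x h. h \<in> H \<Longrightarrow> f (x + h) = (\<Sum>i\<in>I. fs i x * \<phi> i h)"
  shows "f \<in> PG"
proof -
  obtain r where r: "bij_betw r {..<card I} I"
    using ex_bij_betw_nat_finite[OF assms(3)] by (auto simp: atLeast0LessThan)
  have "f (x + h) = (\<Sum>i<card I. fs (r i) x * \<phi> (r i) h)" if "h \<in> H" for x h
    using eq[OF that] sum.reindex_bij_betw[OF r, of "\<lambda>i. fs i x * \<phi> i h"] by simp
  moreover have "\<forall>i<card I. fs (r i) \<in> Cc \<and> continuous_on H (\<phi> (r i))"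
    using fp r by (auto simp: bij_betw_def)
  ultimately show ?thesis
    unfolding PG_def using assms(1,2)
    by (intro CollectI conjI exI[of _ H] exI[of _ "card I"] exI[of _ "\<lambda>i. fs (r i)"] exI[of _ "\<lambda>i. \<phi> (r i)"]) auto
qed

lemma PG_E:
  assumes "f \<in> PG"
  obtains H and n :: nat and fs \<phi> where "compact_open_subgroup H"
    "\<And>i. i < n \<Longrightarrow> fs i \<in> Cc" "\<And>i. i < n \<Longrightarrow> continuous_on H (\<phi> i)"
    "\<And>x h. h \<in> H \<Longrightarrow> f (x + h) = (\<Sum>i<n. fs i x * \<phi> i h)"
  using assms unfolding PG_def mem_Collect_eq by metis

lemma PG_Cc: "f \<in> PG \<Longrightarrow> f \<in> Cc"
  by (simp add: PG_def)

lemma PG_continuous: "f \<in> PG \<Longrightarrow> continuous_on UNIV f"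
  by (rule Cc_continuous[OF PG_Cc])

lemma PG_zero:
  assumes "compact_open_subgroup (H :: 'g::{topological_group_add, t2_space} set)"
  shows "(\<lambda>x::'g. 0) \<in> PG"
  by (rule PG_I[OF fun_subspace_zero[OF fun_subspace_Cc] assms, of "{}"]) auto

text \<open>The two functions may come with different subgroups; both identities restrict to the
  intersection.\<close>

lemma PG_add:
  fixes f g :: "'g::{topological_group_add, t2_space} \<Rightarrow> complex"
  assumes f: "f \<in> PG" and g: "g \<in> PG"
  shows "(\<lambda>x. f x + g x) \<in> PG"
proof -
  obtain H n fs \<phi> where F: "compact_open_subgroup H"
    "\<And>i. i < (n::nat) \<Longrightarrow> fs i \<in> Cc" "\<And>i. i < n \<Longrightarrow> continuous_on H (\<phi> i)"
    "\<And>x h. h \<in> H \<Longrightarrow> f (x + h) = (\<Sum>i<n. fs i x * \<phi> i h)"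
    by (rule PG_E[OF f]) (rule that; simp)
  obtain K m gs \<psi> where G: "compact_open_subgroup K"
    "\<And>i. i < (m::nat) \<Longrightarrow> gs i \<in> Cc" "\<And>i. i < m \<Longrightarrow> continuous_on K (\<psi> i)"
    "\<And>x h. h \<in> K \<Longrightarrow> g (x + h) = (\<Sum>i<m. gs i x * \<psi> i h)"
    by (rule PG_E[OF g]) (rule that; simp)
  show ?thesis
  proof (rule PG_I[OF fun_subspace_add[OF fun_subspace_Cc PG_Cc[OF f] PG_Cc[OF g]]
        compact_open_subgroup_Int[OF F(1) G(1)], of "{..<n} <+> {..<m}" "case_sum fs gs" "case_sum \<phi> \<psi>"])
    show "case_sum fs gs i \<in> Cc \<and> continuous_on (H \<inter> K) (case_sum \<phi> \<psi> i)" if "i \<in> {..<n} <+> {..<m}" for i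
      using that F(2) G(2) by (auto intro: continuous_on_subset[OF F(3)] continuous_on_subset[OF G(3)])
    show "f (x + h) + g (x + h) = (\<Sum>i\<in>{..<n} <+> {..<m}. case_sum fs gs i x * case_sum \<phi> \<psi> i h)"
      if "h \<in> H \<inter> K" for x h
      using F(4) G(4) that by (simp add: sum.Plus comp_def)
  qed simp
qed

lemma PG_mult:
  fixes f g :: "'g::{topological_group_add, t2_space} \<Rightarrow> complex"
  assumes f: "f \<in> PG" and g: "g \<in> PG"
  shows "(\<lambda>x. f x * g x) \<in> PG"
proof -
  obtain H n fs \<phi> where F: "compact_open_subgroup H"
    "\<And>i. i < (n::nat) \<Longrightarrow> fs i \<in> Cc" "\<And>i. i < n \<Longrightarrow> continuous_on H (\<phi> i)"
    "\<And>x h. h \<in> H \<Longrightarrow> f (x + h) = (\<Sum>i<n. fs i x * \<phi> i h)"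
    by (rule PG_E[OF f]) (rule that; simp)
  obtain K m gs \<psi> where G: "compact_open_subgroup K"
    "\<And>i. i < (m::nat) \<Longrightarrow> gs i \<in> Cc" "\<And>i. i < m \<Longrightarrow> continuous_on K (\<psi> i)"
    "\<And>x h. h \<in> K \<Longrightarrow> g (x + h) = (\<Sum>i<m. gs i x * \<psi> i h)"
    by (rule PG_E[OF g]) (rule that; simp)
  show ?thesis
  proof (rule PG_I[OF Cc_mult[OF PG_continuous[OF f] PG_Cc[OF g]] compact_open_subgroup_Int[OF F(1) G(1)],
        of "{..<n} \<times> {..<m}" "\<lambda>(i, j) x. fs i x * gs j x" "\<lambda>(i, j) h. \<phi> i h * \<psi> j h"])
    show "(case i of (i, j) \<Rightarrow> \<lambda>x. fs i x * gs j x) \<in> Cc \<and>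
        continuous_on (H \<inter> K) (case i of (i, j) \<Rightarrow> \<lambda>h. \<phi> i h * \<psi> j h)" if "i \<in> {..<n} \<times> {..<m}" for i
      using that by (auto intro!: Cc_mult Cc_continuous F(2) G(2) continuous_intros
          continuous_on_subset[OF F(3)] continuous_on_subset[OF G(3)])
    show "f (x + h) * g (x + h) = (\<Sum>i\<in>{..<n} \<times> {..<m}.
        (case i of (i, j) \<Rightarrow> \<lambda>x. fs i x * gs j x) x * (case i of (i, j) \<Rightarrow> \<lambda>h. \<phi> i h * \<psi> j h) h)"
      if "h \<in> H \<inter> K" for x h
      using F(4) G(4) that
      by (simp add: sum_product sum.cartesian_product case_prod_unfold mult_ac)
  qed simp
qed

lemma PG_cmult:
  fixes f :: "'g::{topological_group_add, t2_space} \<Rightarrow> complex"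
  assumes f: "f \<in> PG"
  shows "(\<lambda>x. c * f x) \<in> PG"
proof -
  obtain H n fs \<phi> where F: "compact_open_subgroup H"
    "\<And>i. i < (n::nat) \<Longrightarrow> fs i \<in> Cc" "\<And>i. i < n \<Longrightarrow> continuous_on H (\<phi> i)"
    "\<And>x h. h \<in> H \<Longrightarrow> f (x + h) = (\<Sum>i<n. fs i x * \<phi> i h)"
    by (rule PG_E[OF f]) (rule that; simp)
  show ?thesis
    by (rule PG_I[OF fun_subspace_cmult[OF fun_subspace_Cc PG_Cc[OF f]] F(1), of "{..<n}" "\<lambda>i x. c * fs i x" \<phi>])
      (use F(2-4) in \<open>auto simp: sum_distrib_left mult.assoc intro!: fun_subspace_cmult[OF fun_subspace_Cc]\<close>)
qed

lemma PG_cnj: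
  fixes f :: "'g::{topological_group_add, t2_space} \<Rightarrow> complex"
  assumes f: "f \<in> PG"
  shows "(\<lambda>x. cnj (f x)) \<in> PG"
proof -
  obtain H n fs \<phi> where F: "compact_open_subgroup H"
    "\<And>i. i < (n::nat) \<Longrightarrow> fs i \<in> Cc" "\<And>i. i < n \<Longrightarrow> continuous_on H (\<phi> i)"
    "\<And>x h. h \<in> H \<Longrightarrow> f (x + h) = (\<Sum>i<n. fs i x * \<phi> i h)"
    by (rule PG_E[OF f]) (rule that; simp)
  show ?thesis
    by (rule PG_I[OF Cc_cnj[OF PG_Cc[OF f]] F(1), of "{..<n}" "\<lambda>i x. cnj (fs i x)" "\<lambda>i h. cnj (\<phi> i h)"])
      (use F(2-4) in \<open>auto intro!: Cc_cnj continuous_intros\<close>)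
qed

lemma PG_left:
  fixes f :: "'g::{topological_group_add, t2_space} \<Rightarrow> complex"
  assumes f: "f \<in> PG"
  shows "(\<lambda>x. f (a + x)) \<in> PG"
proof -
  obtain H n fs \<phi> where F: "compact_open_subgroup H"
    "\<And>i. i < (n::nat) \<Longrightarrow> fs i \<in> Cc" "\<And>i. i < n \<Longrightarrow> continuous_on H (\<phi> i)"
    "\<And>x h. h \<in> H \<Longrightarrow> f (x + h) = (\<Sum>i<n. fs i x * \<phi> i h)"
    by (rule PG_E[OF f]) (rule that; simp)
  show ?thesis
    by (rule PG_I[OF Cc_left[OF PG_Cc[OF f]] F(1), of "{..<n}" "\<lambda>i x. fs i (a + x)" \<phi>])
      (use F(2-4) in \<open>auto simp: add.assoc[symmetric] intro!: Cc_left\<close>)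
qed

text \<open>Right translation changes the subgroup:
  \<open>x + h + a = (x + a) + (- a + h + a)\<close>, and the last bracket lies in \<open>H\<close>
  exactly for \<open>h\<close> in this conjugate.\<close>

lemma compact_open_subgroup_conj:
  fixes H :: "'g::{topological_group_add, t2_space} set"
  assumes H: "compact_open_subgroup H"
  shows "compact_open_subgroup {h. - a + h + a \<in> H}"
proof -
  have 1: "{h. - a + h + a \<in> H} = (\<lambda>h. a + h + - a) ` H"
  proof (intro subset_antisym subsetI)
    fix h assume "h \<in> {h. - a + h + a \<in> H}"
    then show "h \<in> (\<lambda>h. a + h + - a) ` H"
      by (intro image_eqI[of _ _ "- a + h + a"]) (simp_all add: add.assoc del: add_uminus_conv_diff)
  qed (auto simp: add.assoc simp del: add_uminus_conv_diff)
  have 2: "compact {h. - a + h + a \<in> H}"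
    unfolding 1 using H by (intro compact_continuous_image continuous_intros) (simp add: compact_open_subgroup_def)
  have 3: "open {h. - a + h + a \<in> H}"
    using H by (intro open_vimage[of H "\<lambda>h. - a + h + a", unfolded vimage_def] continuous_intros)
      (simp add: compact_open_subgroup_def)
  have add: "- a + (x + y) + a = (- a + x + a) + (- a + y + a)" for x y
    by (metis add.assoc add.left_neutral add.right_inverse)
  have minus: "- a + - x + a = - (- a + x + a)" for x
    by (simp add: minus_add add.assoc)
  show ?thesis
    using H 2 3 unfolding compact_open_subgroup_def mem_Collect_eq add minus by auto
qed

lemma PG_right:
  fixes f :: "'g::{topological_group_add, t2_space} \<Rightarrow> complex"
  assumes f: "f \<in> PG"
  shows "(\<lambda>x. f (x + a)) \<in> PG"
proof -
  obtain H n fs \<phi> where F: "compact_open_subgroup H"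
    "\<And>i. i < (n::nat) \<Longrightarrow> fs i \<in> Cc" "\<And>i. i < n \<Longrightarrow> continuous_on H (\<phi> i)"
    "\<And>x h. h \<in> H \<Longrightarrow> f (x + h) = (\<Sum>i<n. fs i x * \<phi> i h)"
    by (rule PG_E[OF f]) (rule that; simp)
  show ?thesis
  proof (rule PG_I[OF Cc_right[OF PG_Cc[OF f]] compact_open_subgroup_conj[OF F(1), of a], of "{..<n}"
        "\<lambda>i x. fs i (x + a)" "\<lambda>i h. \<phi> i (- a + h + a)"])
    show "(\<lambda>x. fs i (x + a)) \<in> Cc \<and> continuous_on {h. - a + h + a \<in> H} (\<lambda>h. \<phi> i (- a + h + a))"
      if "i \<in> {..<n}" for i
      using that F(2,3) by (auto intro!: Cc_right continuous_on_compose2[OF F(3)] continuous_intros)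
    show "f (x + h + a) = (\<Sum>i<n. fs i (x + a) * \<phi> i (- a + h + a))" if "h \<in> {h. - a + h + a \<in> H}" for x h
      using F(4)[of "- a + h + a" "x + a"] that by (simp add: add.assoc)
  qed simp
qed

text \<open>The function is constant on left cosets of \<open>H\<close>, so a single term suffices.
  It provides cutoffs and separates points of different cosets.\<close>

lemma PG_indicator:
  fixes H :: "'g::{topological_group_add, t2_space} set"
  assumes H: "compact_open_subgroup H"
  shows "(\<lambda>x. if x \<in> H then 1 else 0) \<in> PG"
proof -
  interpret compact_open_group H by unfold_locales (rule H)
  let ?i = "\<lambda>x. if x \<in> H then 1 else 0 :: complex"
  have i: "?i \<in> Cc"
    by (rule Cc_I[of _ H]) (auto intro: continuous_cutoff compact_H split: if_splits)
  show ?thesis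
    by (rule PG_I[OF i H, of "{()}" "\<lambda>_. ?i" "\<lambda>_ _. 1"]) (auto intro: i)
qed

lemma PG_cutoff:
  fixes f :: "'g::{topological_group_add, t2_space} \<Rightarrow> complex"
  assumes "compact_open_subgroup H" "f \<in> PG"
  shows "(\<lambda>x. if x \<in> H then f x else 0) \<in> PG"
proof -
  have "(\<lambda>x. (if x \<in> H then 1 else 0) * f x) \<in> PG"
    by (rule PG_mult[OF PG_indicator[OF assms(1)] assms(2)])
  then show ?thesis
    by (simp add: if_distrib[of "\<lambda>c. c * _"] cong: if_cong)
qed

lemma fun_subspace_PG:
  assumes "compact_open_subgroup (H :: 'g::{topological_group_add, t2_space} set)"
  shows "fun_subspace (PG :: ('g \<Rightarrow> complex) set)"
  unfolding fun_subspace_def using PG_zero[OF assms] PG_add PG_cmult by auto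

section \<open>Splitting inside P(G), cosets and the antipode\<close>

text \<open>The definition places the first factors in \<open>Cc\<close> and asks for continuity of
  the second ones on \<open>H\<close>. Elimination improves one factor at a time: first to
  combinations of right translates of \<open>f\<close>, then, with the roles exchanged, to
  combinations of left translates cut off outside \<open>H\<close>.\<close>

lemma PG_split:
  fixes f :: "'g::{topological_group_add, t2_space} \<Rightarrow> complex"
  assumes f: "f \<in> PG"
  obtains H and n :: nat and p q where "compact_open_subgroup H"
    "\<forall>i<n. p i \<in> PG" "\<forall>i<n. q i \<in> PG"
    "\<forall>x. \<forall>h\<in>H. f (x + h) = (\<Sum>i<n. p i x * q i h)"
proof -
  obtain H n fs \<phi> where F: "compact_open_subgroup H"
    "\<And>i. i < (n::nat) \<Longrightarrow> fs i \<in> Cc" "\<And>i. i < n \<Longrightarrow> continuous_on H (\<phi> i)"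
    "\<And>x h. h \<in> H \<Longrightarrow> f (x + h) = (\<Sum>i<n. fs i x * \<phi> i h)"
    by (rule PG_E[OF f]) (rule that; simp)
  note V = fun_subspace_PG[OF F(1)]
  \<comment> \<open>The second factors are so far controlled on \<open>H\<close> alone, so the first
    pass puts no constraint on them.\<close>
  have "fun_subspace (UNIV :: ('g \<Rightarrow> complex) set)"
    by (simp add: fun_subspace_def)
  then have "\<exists>(m::nat) p q. (\<forall>i<m. p i \<in> PG \<and> q i \<in> UNIV) \<and> (\<forall>x. \<forall>h\<in>H. f (x + h) = (\<Sum>i<m. p i x * q i h))"
    by (rule separated_sections[OF V _ F(4)]) (simp_all add: PG_right[OF f])
  then obtain m :: nat and p q where pq: "\<forall>i<m. p i \<in> PG" "\<forall>x. \<forall>h\<in>H. f (x + h) = (\<Sum>i<m. p i x * q i h)"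
    by blast
  have "(if h \<in> H then f (x + h) else 0) = (\<Sum>i<m. (if h \<in> H then q i h else 0) * p i x)" for h x
    using pq(2) by (simp add: mult.commute)
  then have "\<exists>(k::nat) q' p'. (\<forall>i<k. q' i \<in> PG \<and> p' i \<in> PG) \<and>
      (\<forall>h. \<forall>x\<in>UNIV. (if h \<in> H then f (x + h) else 0) = (\<Sum>i<k. q' i h * p' i x))"
    by (rule separated_sections[OF V V]) (use pq(1) PG_cutoff[OF F(1) PG_left[OF f]] in auto)
  then obtain k :: nat and q' p' where pq': "\<forall>i<k. q' i \<in> PG \<and> p' i \<in> PG"
    "\<forall>h. \<forall>x\<in>UNIV. (if h \<in> H then f (x + h) else 0) = (\<Sum>i<k. q' i h * p' i x)"
    by blast
  have "f (x + h) = (\<Sum>i<k. p' i x * q' i h)" if "h \<in> H" for x h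
    using pq'(2)[rule_format, of x h] that by (simp add: mult.commute)
  with pq'(1) F(1) that[of H k p' q'] show thesis
    by blast
qed

text \<open>The compact support is covered by finitely many left cosets \<open>j + H\<close>. Each
  must be listed once, or values would be counted twice; \<open>r\<close> picks one representative
  per coset.\<close>

lemma coset_decomposition:
  fixes f :: "'g::{topological_group_add, t2_space} \<Rightarrow> complex"
  assumes f: "f \<in> Cc" and H: "compact_open_subgroup H"
  shows "\<exists>J. finite J \<and> (\<forall>x. f x = (\<Sum>j\<in>J. if - j + x \<in> H then f x else 0))"
proof -
  interpret compact_open_group H by unfold_locales (rule H)
  obtain K where K: "compact K" "\<And>x. f x \<noteq> 0 \<Longrightarrow> x \<in> K"
    using f unfolding Cc_iff by blast
  have "open {x. - j + x \<in> H}" for j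
    by (rule open_vimage[OF open_H, of "\<lambda>x. - j + x", unfolded vimage_def]) (intro continuous_intros)
  moreover have "K \<subseteq> (\<Union>j\<in>K. {x. - j + x \<in> H})"
    by auto
  ultimately obtain J0 where J0: "finite J0" "K \<subseteq> (\<Union>j\<in>J0. {x. - j + x \<in> H})"
    using compactE_image[OF K(1), of K "\<lambda>j. {x. - j + x \<in> H}"] by metis
  define r where "r x = (SOME y. - y + x \<in> H)" for x
  have r: "- r x + x \<in> H" for x
    unfolding r_def by (rule someI[of _ x]) simp
  have trans: "- y + z \<in> H" if "- y + x \<in> H" "- x + z \<in> H" for x y z
    using add_H[OF that] by (simp add: add.assoc[symmetric])
  have sym: "- y + x \<in> H" if "- x + y \<in> H" for x y
    using minus_H[OF that] by (simp add: minus_add)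
  have r_eq: "r x = r y" if "- x + y \<in> H" for x y
  proof -
    have "(\<lambda>z. - z + x \<in> H) = (\<lambda>z. - z + y \<in> H)"
      using trans sym that by blast
    then show ?thesis
      by (simp add: r_def)
  qed
  have "f x = (\<Sum>j\<in>r ` J0. if - j + x \<in> H then f x else 0)" for x
  proof (cases "f x = 0")
    case False
    then obtain j0 where j0: "j0 \<in> J0" "- j0 + x \<in> H"
      using K(2) J0(2) by blast
    have iff: "- j + x \<in> H \<longleftrightarrow> j = r j0" if j: "j \<in> r ` J0" for j
    proof
      obtain i where i: "j = r i" using j by blast
      assume "- j + x \<in> H"
      then have "- i + x \<in> H"
        using trans[of i j x] sym[OF r[of i]] i by simp
      then show "j = r j0"
        unfolding i using r_eq trans[OF _ sym[OF j0(2)]] by blast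
    next
      assume "j = r j0"
      then show "- j + x \<in> H"
        using trans[OF r[of j0] j0(2)] by simp
    qed
    have "(\<Sum>j\<in>r ` J0. if - j + x \<in> H then f x else 0) = (\<Sum>j\<in>r ` J0. if j = r j0 then f x else 0)"
      using iff by (intro sum.cong) auto
    also have "\<dots> = f x"
      using J0(1) j0(1) by simp
    finally show ?thesis ..
  qed (simp cong: if_cong)
  with J0(1) show ?thesis
    by blast
qed

text \<open>Inversion reverses the order: \<open>j + - (x + h) = (j + - h) + - x\<close>, so on a
  coset of \<open>H\<close> the two factors of the splitting trade places. The pieces in
  \<open>part\<close> are then moved back by right translations and added up.\<close>

lemma PG_antipode:
  fixes f :: "'g::{topological_group_add, t2_space} \<Rightarrow> complex"
  assumes f: "f \<in> PG"
  shows "(\<lambda>x. f (- x)) \<in> PG"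
proof -
  obtain H n p q where split: "compact_open_subgroup H"
    "\<forall>i<(n::nat). p i \<in> PG" "\<forall>i<n. q i \<in> PG"
    "\<forall>x. \<forall>h\<in>H. f (x + h) = (\<Sum>i<n. p i x * q i h)"
    by (rule PG_split[OF f])
  note S = split(1) split(2-4)[rule_format]
  interpret compact_open_group H by unfold_locales (rule S(1))
  obtain J where J: "finite J" "\<And>x. f x = (\<Sum>j\<in>J. if - j + x \<in> H then f x else 0)"
    using coset_decomposition[OF PG_Cc[OF f] S(1)] by blast
  have part: "(\<lambda>x. if x \<in> H then f (j + - x) else 0) \<in> PG" for j
  proof (rule PG_I[OF _ S(1), of _ "{..<n}" "\<lambda>i x. if x \<in> H then q i (- x) else 0" "\<lambda>i h. p i (j + - h)"])
    have "(\<lambda>x. if - x \<in> H then f (j + - x) else 0) \<in> Cc"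
      by (rule Cc_minus[OF PG_Cc[OF PG_cutoff[OF S(1) PG_left[OF f]]]])
    then show "(\<lambda>x. if x \<in> H then f (j + - x) else 0) \<in> Cc"
      by simp
    show "(\<lambda>x. if x \<in> H then q i (- x) else 0) \<in> Cc \<and> continuous_on H (\<lambda>h. p i (j + - h))"
      if i: "i \<in> {..<n}" for i
    proof
      have "(\<lambda>x. if - x \<in> H then q i (- x) else 0) \<in> Cc"
        using i by (intro Cc_minus[OF PG_Cc[OF PG_cutoff[OF S(1) S(3)]]]) simp
      then show "(\<lambda>x. if x \<in> H then q i (- x) else 0) \<in> Cc"
        by simp
      show "continuous_on H (\<lambda>h. p i (j + - h))"
        using i by (intro continuous_on_compose2[OF PG_continuous[OF S(2)], of i H "\<lambda>h. j + - h"] continuous_intros) auto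
    qed
    show "(if x + h \<in> H then f (j + - (x + h)) else 0) = (\<Sum>i<n. (if x \<in> H then q i (- x) else 0) * p i (j + - h))"
      if "h \<in> H" for x h
    proof (cases "x \<in> H")
      case True
      have "f (j + - (x + h)) = f (j + - h + - x)"
        by (simp add: minus_add add.assoc del: add_uminus_conv_diff)
      then show ?thesis
        using S(4)[of "- x" "j + - h"] True that by (simp add: mult.commute)
    qed (use that in simp)
  qed simp
  have "(\<lambda>x. \<Sum>j\<in>J. if x + j \<in> H then f (j + - (x + j)) else 0) \<in> PG"
    by (rule fun_subspace_sum[OF fun_subspace_PG[OF S(1)]]) (rule PG_right[OF part])
  moreover have "(\<lambda>x. f (- x)) = (\<lambda>x. \<Sum>j\<in>J. if x + j \<in> H then f (j + - (x + j)) else 0)"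
  proof
    fix x
    have "- j + - x \<in> H \<longleftrightarrow> x + j \<in> H" for j
      using minus_H_iff[of "x + j"] by (simp add: minus_add)
    moreover have "j + - (x + j) = - x" for j
      by (simp add: minus_add del: add_uminus_conv_diff)
    ultimately show "f (- x) = (\<Sum>j\<in>J. if x + j \<in> H then f (j + - (x + j)) else 0)"
      using J(2)[of "- x"] by (simp cong: if_cong)
  qed
  ultimately show ?thesis
    by simp
qed

lemma right_coset_decomposition:
  fixes f :: "'g::{topological_group_add, t2_space} \<Rightarrow> complex"
  assumes f: "f \<in> Cc" and H: "compact_open_subgroup H"
  shows "\<exists>J. finite J \<and> (\<forall>x. f x = (\<Sum>j\<in>J. if x + j \<in> H then f x else 0))"
proof -
  interpret compact_open_group H by unfold_locales (rule H)
  obtain J where J: "finite J" "\<And>x. f (- x) = (\<Sum>j\<in>J. if - j + x \<in> H then f (- x) else 0)"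
    using coset_decomposition[OF Cc_minus[OF f] H] by blast
  have "- j + - x \<in> H \<longleftrightarrow> x + j \<in> H" for j x
    using minus_H_iff[of "x + j"] by (simp add: minus_add)
  then have "f x = (\<Sum>j\<in>J. if x + j \<in> H then f x else 0)" for x
    using J(2)[of "- x"] unfolding minus_minus by simp
  with J(1) show ?thesis
    by blast
qed

section \<open>Tensors and the span condition\<close>

lemma alg_tensor_single: "a \<in> A \<Longrightarrow> b \<in> A \<Longrightarrow> (\<lambda>(x, y). a x * b y) \<in> alg_tensor A"
  unfolding alg_tensor_def
  by (intro CollectI exI[of _ "1::nat"] exI[of _ "\<lambda>_. a"] exI[of _ "\<lambda>_. b"]) auto

lemma fun_subspace_alg_tensor:
  assumes "fun_subspace A"
  shows "fun_subspace (alg_tensor A)"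
  unfolding fun_subspace_def
proof (intro conjI ballI allI)
  show "(\<lambda>x. 0) \<in> alg_tensor A"
    unfolding alg_tensor_def by (intro CollectI exI[of _ "0::nat"]) auto
next
  fix F G assume "F \<in> alg_tensor A" "G \<in> alg_tensor A"
  then obtain n m :: nat and a b a' b' where F: "F = (\<lambda>(x, y). \<Sum>i<n. a i x * b i y)" "\<forall>i<n. a i \<in> A \<and> b i \<in> A"
    and G: "G = (\<lambda>(x, y). \<Sum>i<m. a' i x * b' i y)" "\<forall>i<m. a' i \<in> A \<and> b' i \<in> A"
    unfolding alg_tensor_def by blast
  define c where "c i = (if i < n then a i else a' (i - n))" for i
  define d where "d i = (if i < n then b i else b' (i - n))" for i
  have "(\<Sum>i<n + m. c i x * d i y) = (\<Sum>i<n. a i x * b i y) + (\<Sum>i<m. a' i x * b' i y)" for x y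
    unfolding sum_lessThan_append[symmetric] by (intro sum.cong) (auto simp: c_def d_def)
  then have "(\<lambda>z. F z + G z) = (\<lambda>(x, y). \<Sum>i<n + m. c i x * d i y)"
    by (auto simp: F(1) G(1))
  moreover have "\<forall>i<n + m. c i \<in> A \<and> d i \<in> A"
    using F(2) G(2) by (auto simp: c_def d_def)
  ultimately show "(\<lambda>z. F z + G z) \<in> alg_tensor A"
    unfolding alg_tensor_def by blast
next
  fix k F assume "F \<in> alg_tensor A"
  then obtain n :: nat and a b where F: "F = (\<lambda>(x, y). \<Sum>i<n. a i x * b i y)" "\<forall>i<n. a i \<in> A \<and> b i \<in> A"
    unfolding alg_tensor_def by blast
  have "(\<lambda>z. k * F z) = (\<lambda>(x, y). \<Sum>i<n. (\<lambda>x. k * a i x) x * b i y)"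
    by (auto simp: F(1) sum_distrib_left mult.assoc)
  moreover have "\<forall>i<n. (\<lambda>x. k * a i x) \<in> A \<and> b i \<in> A"
    using F(2) fun_subspace_cmult[OF assms] by auto
  ultimately show "(\<lambda>z. k * F z) \<in> alg_tensor A"
    unfolding alg_tensor_def
    by (intro CollectI exI[of _ n] exI[of _ "\<lambda>i x. k * a i x"] exI[of _ b]) auto
qed

lemma cspan_fun_subset:
  assumes "fun_subspace T" "S \<subseteq> T"
  shows "cspan_fun S \<subseteq> T"
  using assms unfolding cspan_fun_def
  by (auto intro!: fun_subspace_sum fun_subspace_cmult)

lemma cspan_fun_superset: "S \<subseteq> cspan_fun S"
proof
  fix F assume "F \<in> S"
  then show "F \<in> cspan_fun S"
    unfolding cspan_fun_def by (intro CollectI exI[of _ "1::nat"] exI[of _ "\<lambda>_. 1"] exI[of _ "\<lambda>_. F"]) auto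
qed

lemma fun_subspace_cspan_fun: "fun_subspace (cspan_fun S)"
  unfolding fun_subspace_def
proof (intro conjI ballI allI)
  show "(\<lambda>x. 0) \<in> cspan_fun S"
    unfolding cspan_fun_def by (intro CollectI exI[of _ "0::nat"]) auto
next
  fix f g assume "f \<in> cspan_fun S" "g \<in> cspan_fun S"
  then obtain n m :: nat and c d F G where f: "f = (\<lambda>z. \<Sum>i<n. c i * F i z)" "\<forall>i<n. F i \<in> S"
    and g: "g = (\<lambda>z. \<Sum>i<m. d i * G i z)" "\<forall>i<m. G i \<in> S"
    unfolding cspan_fun_def by blast
  define e where "e i = (if i < n then c i else d (i - n))" for i
  define E where "E i = (if i < n then F i else G (i - n))" for i
  have "(\<Sum>i<n + m. e i * E i z) = (\<Sum>i<n. c i * F i z) + (\<Sum>i<m. d i * G i z)" for z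
    unfolding sum_lessThan_append[symmetric] by (intro sum.cong) (auto simp: e_def E_def)
  then have "(\<lambda>z. f z + g z) = (\<lambda>z. \<Sum>i<n + m. e i * E i z)"
    by (simp add: f(1) g(1))
  moreover have "\<forall>i<n + m. E i \<in> S"
    using f(2) g(2) by (auto simp: E_def)
  ultimately show "(\<lambda>z. f z + g z) \<in> cspan_fun S"
    unfolding cspan_fun_def by blast
next
  fix k f assume "f \<in> cspan_fun S"
  then obtain n :: nat and c F where f: "f = (\<lambda>z. \<Sum>i<n. c i * F i z)" "\<forall>i<n. F i \<in> S"
    unfolding cspan_fun_def by blast
  then have "(\<lambda>z. k * f z) = (\<lambda>z. \<Sum>i<n. (k * c i) * F i z)"
    by (simp add: sum_distrib_left mult.assoc)
  with f(2) show "(\<lambda>z. k * f z) \<in> cspan_fun S"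
    unfolding cspan_fun_def
    by (intro CollectI exI[of _ n] exI[of _ "\<lambda>i. k * c i"] exI[of _ F]) auto
qed

lemma delta_one_in_alg_tensor_PG:
  fixes f g :: "'g::{topological_group_add, t2_space} \<Rightarrow> complex"
  assumes f: "f \<in> PG" and g: "g \<in> PG"
  shows "delta_one f g \<in> alg_tensor PG"
proof -
  obtain H n p q where split: "compact_open_subgroup H"
    "\<forall>i<(n::nat). p i \<in> PG" "\<forall>i<n. q i \<in> PG"
    "\<forall>x. \<forall>h\<in>H. f (x + h) = (\<Sum>i<n. p i x * q i h)"
    by (rule PG_split[OF f])
  note S = split(1) split(2-4)[rule_format]
  obtain J where J: "finite J" "\<And>x. g x = (\<Sum>j\<in>J. if - j + x \<in> H then g x else 0)"
    using coset_decomposition[OF PG_Cc[OF g] S(1)] by blast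
  note T = fun_subspace_alg_tensor[OF fun_subspace_PG[OF S(1)]]
  \<comment> \<open>The cutoff of \<open>q i\<close> makes the term vanish for \<open>y\<close> off
    the coset \<open>j + H\<close>, which absorbs the case distinction.\<close>
  define b where "b i j y = (if - j + y \<in> H then q i (- j + y) else 0) * g y" for i j y
  have b: "b i j \<in> PG" if "i < n" for i j
    unfolding b_def[abs_def]
    by (rule PG_mult[OF PG_left[OF PG_cutoff[OF S(1) S(3)[OF that]]] g])
  have "(\<lambda>z. \<Sum>j\<in>J. \<Sum>i<n. (\<lambda>(x, y). p i (x + j) * b i j y) z) \<in> alg_tensor PG"
    by (intro fun_subspace_sum[OF T] alg_tensor_single PG_right S(2) b) simp_all
  moreover have "delta_one f g = (\<lambda>z. \<Sum>j\<in>J. \<Sum>i<n. (\<lambda>(x, y). p i (x + j) * b i j y) z)"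
  proof
    fix z :: "'g \<times> 'g"
    obtain x y where z: "z = (x, y)"
      by (cases z)
    have "f (x + y) * g y = (\<Sum>j\<in>J. if - j + y \<in> H then f (x + y) * g y else 0)"
      by (subst J(2)) (simp add: sum_distrib_left if_distrib cong: if_cong)
    also have "\<dots> = (\<Sum>j\<in>J. \<Sum>i<n. p i (x + j) * b i j y)"
    proof (intro sum.cong refl)
      fix j
      have "x + y = (x + j) + (- j + y)"
        by (metis add.assoc add.left_neutral add.right_inverse)
      then show "(if - j + y \<in> H then f (x + y) * g y else 0) = (\<Sum>i<n. p i (x + j) * b i j y)"
        using S(4)[of "- j + y" "x + j"] by (simp add: b_def sum_distrib_right mult.assoc)
    qed
    finally show "delta_one f g z = (\<Sum>j\<in>J. \<Sum>i<n. (\<lambda>(x, y). p i (x + j) * b i j y) z)"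
      by (simp add: delta_one_def z)
  qed
  ultimately show ?thesis
    by simp
qed

text \<open>Splitting \<open>a\<close> at \<open>x = (x + y + j) + - (y + j)\<close> requires
  \<open>- (y + j)\<close> to lie in \<open>H\<close>. Hence \<open>b\<close> is cut along right
  cosets, and the second factor stays in \<open>PG\<close> by closure under the antipode.\<close>

lemma tensor_in_span_delta_one_PG:
  fixes a b :: "'g::{topological_group_add, t2_space} \<Rightarrow> complex"
  assumes a: "a \<in> PG" and b: "b \<in> PG"
  shows "(\<lambda>(x, y). a x * b y) \<in> cspan_fun {delta_one f g | f g. f \<in> PG \<and> g \<in> PG}" (is "_ \<in> ?C")
proof -
  obtain H n p q where split: "compact_open_subgroup H"
    "\<forall>i<(n::nat). p i \<in> PG" "\<forall>i<n. q i \<in> PG"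
    "\<forall>x. \<forall>h\<in>H. a (x + h) = (\<Sum>i<n. p i x * q i h)"
    by (rule PG_split[OF a])
  note S = split(1) split(2-4)[rule_format]
  interpret compact_open_group H by unfold_locales (rule S(1))
  obtain J where J: "finite J" "\<And>x. b x = (\<Sum>j\<in>J. if x + j \<in> H then b x else 0)"
    using right_coset_decomposition[OF PG_Cc[OF b] S(1)] by blast
  define c where "c i j y = (if - (y + j) \<in> H then q i (- (y + j)) else 0) * b y" for i j y
  have c: "c i j \<in> PG" if "i < n" for i j
    unfolding c_def[abs_def]
    by (rule PG_mult[OF PG_right[OF PG_antipode[OF PG_cutoff[OF S(1) S(3)[OF that]]]] b])
  have "(\<lambda>z. \<Sum>j\<in>J. \<Sum>i<n. delta_one (\<lambda>u. p i (u + j)) (c i j) z) \<in> ?C"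
    by (intro fun_subspace_sum[OF fun_subspace_cspan_fun] subsetD[OF cspan_fun_superset])
      (use c S(2) PG_right in blast)
  moreover have "(\<lambda>(x, y). a x * b y) = (\<lambda>z. \<Sum>j\<in>J. \<Sum>i<n. delta_one (\<lambda>u. p i (u + j)) (c i j) z)"
  proof
    fix z :: "'g \<times> 'g"
    obtain x y where z: "z = (x, y)"
      by (cases z)
    have "a x * b y = (\<Sum>j\<in>J. if y + j \<in> H then a x * b y else 0)"
      by (subst J(2)) (simp add: sum_distrib_left if_distrib cong: if_cong)
    also have "\<dots> = (\<Sum>j\<in>J. \<Sum>i<n. p i (x + y + j) * c i j y)"
    proof (intro sum.cong refl)
      fix j
      have "x = (x + y + j) + - (y + j)"
        by (simp add: minus_add add.assoc del: add_uminus_conv_diff)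
      then show "(if y + j \<in> H then a x * b y else 0) = (\<Sum>i<n. p i (x + y + j) * c i j y)"
        using S(4)[of "- (y + j)" "x + y + j"] by (simp add: c_def sum_distrib_right mult.assoc)
    qed
    finally show "(\<lambda>(x, y). a x * b y) z = (\<Sum>j\<in>J. \<Sum>i<n. delta_one (\<lambda>u. p i (u + j)) (c i j) z)"
      by (simp add: delta_one_def z)
  qed
  ultimately show ?thesis
    by simp
qed

section \<open>Separation of the points of G\<close>

text \<open>For \<open>x\<close> outside \<open>H\<close> and \<open>h\<close> in \<open>H\<close>,
  \<open>p (x + h)\<close> and all \<open>a i x\<close> vanish, so the identity on \<open>H\<close>
  holds for every \<open>x\<close> in the group.\<close>

lemma PG_of_rep:
  fixes H :: "'g::{topological_group_add, t2_space} set"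
  assumes H: "compact_open_subgroup H" and p: "compact_open_group.rep H p"
  shows "(\<lambda>x. complex_of_real (p x)) \<in> PG"
proof -
  interpret compact_open_group H by unfold_locales (rule H)
  obtain n :: nat and a b where ab: "\<forall>i<n. a i \<in> CH \<and> b i \<in> CH"
    "\<forall>x\<in>H. \<forall>h\<in>H. p (x + h) = (\<Sum>i<n. a i x * b i h)"
    using p unfolding rep_def by blast
  have Cc: "(\<lambda>x. complex_of_real (f x)) \<in> Cc" if "f \<in> CH" for f
    by (rule Cc_I[OF _ compact_H]) (use that in \<open>auto simp: CH_def intro!: continuous_intros\<close>)
  show ?thesis
  proof (rule PG_I[OF Cc[OF rep_CH[OF p]] H, of "{..<n}" "\<lambda>i x. of_real (a i x)" "\<lambda>i h. of_real (b i h)"])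
    show "(\<lambda>x. complex_of_real (a i x)) \<in> Cc \<and> continuous_on H (\<lambda>h. complex_of_real (b i h))" if "i \<in> {..<n}" for i
      using that ab(1) by (auto intro!: Cc continuous_intros continuous_on_subset[OF CH_continuous])
    show "complex_of_real (p (x + h)) = (\<Sum>i<n. of_real (a i x) * of_real (b i h))" if h: "h \<in> H" for x h
    proof (cases "x \<in> H")
      case True
      then show ?thesis
        using ab(2) h by simp
    next
      case False
      then have "p (x + h) = 0" "\<forall>i<n. a i x = 0"
        using CH_outside rep_CH[OF p] ab(1) h by auto
      then show ?thesis by simp
    qed
  qed simp
qed

text \<open>A left translation moves \<open>x\<close> to \<open>0\<close>. If \<open>- x + y\<close>
  lies outside \<open>H\<close>, the indicator of \<open>H\<close> separates; otherwise a
  representative function of \<open>H\<close> does.\<close>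

lemma PG_separates_points:
  fixes H :: "'g::{topological_group_add, t2_space} set"
  assumes H: "compact_open_subgroup H"
  shows "separates_points (PG :: ('g \<Rightarrow> complex) set)"
  unfolding separates_points_def
proof (intro allI impI)
  fix x y :: 'g assume "x \<noteq> y"
  then have ne: "- x + y \<noteq> 0"
    by (metis add.right_neutral minus_add_cancel add_minus_cancel)
  interpret compact_open_group H by unfold_locales (rule H)
  have "\<exists>f\<in>(PG :: ('g \<Rightarrow> complex) set). f 0 \<noteq> f (- x + y)"
  proof (cases "- x + y \<in> H")
    case True
    then obtain p where p: "rep p" "p (- x + y) \<noteq> p 0"
      using rep_separates ne by blast
    then show ?thesis
      using PG_of_rep[OF H p(1)] by (intro bexI[of _ "\<lambda>z. complex_of_real (p z)"]) auto
  next
    case False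
    then show ?thesis
      using PG_indicator[OF H] by (intro bexI[of _ "\<lambda>z. if z \<in> H then 1 else 0"]) auto
  qed
  then obtain f :: "'g \<Rightarrow> complex" where f: "f \<in> PG" "f 0 \<noteq> f (- x + y)"
    by blast
  then show "\<exists>f\<in>(PG :: ('g \<Rightarrow> complex) set). f x \<noteq> f y"
    by (intro bexI[of _ "\<lambda>z. f (- x + z)"] PG_left) auto
qed

theorem theorem3p7:
  assumes "locally_compact_space (euclidean :: 'g::{topological_group_add, t2_space} topology)"
    and "\<exists>H::'g set. compact_open_subgroup H"
  shows "multiplier_hopf_star_subalgebra (PG :: ('g \<Rightarrow> complex) set) \<and>
         separates_points (PG :: ('g \<Rightarrow> complex) set) \<and>
         (\<forall>x::'g. \<forall>f\<in>PG. (\<lambda>y. f (- x + y)) \<in> PG) \<and>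
         (\<forall>x::'g. \<forall>f\<in>PG. (\<lambda>y. f (y + x)) \<in> PG)"
proof -
  obtain H :: "'g set" where H: "compact_open_subgroup H"
    using assms(2) by blast
  let ?D = "{delta_one f g | f g. f \<in> (PG :: ('g \<Rightarrow> complex) set) \<and> g \<in> PG}"
  have "cspan_fun ?D = alg_tensor PG"
  proof
    show "cspan_fun ?D \<subseteq> alg_tensor PG"
      using delta_one_in_alg_tensor_PG
      by (intro cspan_fun_subset fun_subspace_alg_tensor fun_subspace_PG[OF H]) auto
    show "alg_tensor PG \<subseteq> cspan_fun ?D"
    proof
      fix F :: "'g \<times> 'g \<Rightarrow> complex" assume "F \<in> alg_tensor PG"
      then obtain n :: nat and a b where F: "F = (\<lambda>(x, y). \<Sum>i<n. a i x * b i y)" "\<forall>i<n. a i \<in> PG \<and> b i \<in> PG"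
        unfolding alg_tensor_def by blast
      have "(\<lambda>z. \<Sum>i<n. (\<lambda>(x, y). a i x * b i y) z) \<in> cspan_fun ?D"
        using F(2) by (intro fun_subspace_sum[OF fun_subspace_cspan_fun] tensor_in_span_delta_one_PG) auto
      then show "F \<in> cspan_fun ?D"
        by (simp add: F(1) case_prod_unfold)
    qed
  qed
  moreover have "star_subalgebra (PG :: ('g \<Rightarrow> complex) set)"
    unfolding star_subalgebra_def
    by (intro conjI ballI allI PG_zero[OF H] PG_add PG_cmult PG_mult PG_cnj)
  moreover have "(PG :: ('g \<Rightarrow> complex) set) \<subseteq> C0"
    using PG_Cc Cc_subset_C0 by blast
  ultimately have "multiplier_hopf_star_subalgebra (PG :: ('g \<Rightarrow> complex) set)"
    unfolding multiplier_hopf_star_subalgebra_def by (simp add: PG_antipode)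
  then show ?thesis
    by (simp add: PG_separates_points[OF H] PG_left PG_right)
qed

end
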